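(* Let $\phi=\frac{1+\sqrt5}{2}$ and let $P\subset\mathbb{R}^3$ be the regular dodecahedron, i.e. the convex hull of the $20$ points $(\pm1,\pm1,\pm1)$, $(0,\pm\phi,\pm\frac1\phi)$, $(\pm\frac1\phi,0,\pm\phi)$, $(\pm\phi,\pm\frac1\phi,0)$ (all sign choices). Then $P$ is rigid: every continuous deformation of $P$ through convex polytopes of the same combinatorial type that preserves all edge lengths is trivial (every polytope along the deformation is congruent to $P$).
   Context: Let $P$ have vertex set $V$, edge set $E$ and facet set $F$, and write $i\sim\sigma$ if vertex $i\in V$ lies on facet $\sigma\in F$. The realization space of the combinatorial type $\mathcal P=(V,E,F,\sim)$ of $P$ is the set $\mathrm{REAL}(\mathcal P)$ of pairs $(\boldsymbol p,\boldsymbol a)$ of maps $\boldsymbol p:V\to\mathbb{R}^3$, $\boldsymbol a:F\to\mathbb{R}^3$ with $\langle p_i,a_\sigma\rangle=1$ whenever $i\sim\sigma$ and $\langle p_i,a_\sigma\rangle<1$ whenever $i\not\sim\sigma$. The polytope $P$ (which has the origin in its interior) is identified with the element of $\mathrm{REAL}(\mathcal P)$ given by its vertices and its suitably scaled facet normals. Two realizations $(\boldsymbol p,\boldsymbol a),(\tilde{\boldsymbol p},\tilde{\boldsymbol a})$ are equivalent if $\|p_i-p_j\|=\|\tilde p_i-\tilde p_j\|$ for all edges $ij\in E$, and congruent if this holds for all pairs $i,j\in V$. A (continuous) motion of $P$ is a continuous map $[0,1]\to\mathrm{REAL}(\mathcal P)$, $t\mapsto(\boldsymbol p^t,\boldsymbol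 a^t)$, starting at $P$ for $t=0$ and with $(\boldsymbol p^t,\boldsymbol a^t)$ equivalent to $P$ for all $t$. It is trivial if $(\boldsymbol p^t,\boldsymbol a^t)$ is congruent to $P$ for all $t$. $P$ is rigid if all its motions are trivial. *)

theory Defs
  imports "HOL-Analysis.Analysis"
begin

record ('v, 'f) combinatorial_type =
  verts :: "'v set"
  edges :: "'v set set"
  facets :: "'f set"
  incident :: "'v \<Rightarrow> 'f \<Rightarrow> bool"

text \<open>Vertices are labelled by themselves, facets by their point sets, and an edge is the
  unordered pair of its endpoints.\<close>

definition comb_type_of :: "(real^3) set \<Rightarrow> (real^3, (real^3) set) combinatorial_type" where
  "comb_type_of P =
    \<lparr>verts = {v. v extreme_point_of P},
     edges = {{v, w} | v w. v extreme_point_of P \<and> w extreme_point_of P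
                            \<and> closed_segment v w edge_of P},
     facets = {S. S facet_of P},
     incident = (\<lambda>v S. v \<in> S)\<rparr>"

type_synonym ('v, 'f) realization = "('v \<Rightarrow> real^3) \<times> ('f \<Rightarrow> real^3)"

text \<open>Maps defined on \<open>verts C\<close> and \<open>facets C\<close> are extensional functions: they take a fixed
  dummy value elsewhere. Hence the product topology on functions used for motions below
  is, on this set, the topology of the finite-dimensional space of pairs of maps.\<close>

definition REAL :: "('v, 'f) combinatorial_type \<Rightarrow> ('v, 'f) realization set" where
  "REAL C =
    {(p, a). p \<in> verts C \<rightarrow>\<^sub>E UNIV \<and> a \<in> facets C \<rightarrow>\<^sub>E UNIV \<and>
       (\<forall>i\<in>verts C. \<forall>s\<in>facets C.
          (incident C i s \<longrightarrow> p i \<bullet> a s = 1) \<and> (\<not> incident C i s \<longrightarrow> p i \<bullet> a s < 1))}"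

definition edge_equivalent ::
  "('v, 'f) combinatorial_type \<Rightarrow> ('v, 'f) realization \<Rightarrow> ('v, 'f) realization \<Rightarrow> bool" where
  "edge_equivalent C r r' \<longleftrightarrow>
    (\<forall>i j. {i, j} \<in> edges C \<longrightarrow> norm (fst r i - fst r j) = norm (fst r' i - fst r' j))"

definition vertex_congruent ::
  "('v, 'f) combinatorial_type \<Rightarrow> ('v, 'f) realization \<Rightarrow> ('v, 'f) realization \<Rightarrow> bool" where
  "vertex_congruent C r r' \<longleftrightarrow>
    (\<forall>i\<in>verts C. \<forall>j\<in>verts C. norm (fst r i - fst r j) = norm (fst r' i - fst r' j))"

text \<open>If \<open>0\<close> is an interior point of a 3-polytope, the affine hull of a facet is a plane missing
  \<open>0\<close>, so the vector below exists, is unique, and is the outer normal of the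
  facet scaled as in \<open>REAL\<close>.\<close>

definition facet_normal :: "(real^3) set \<Rightarrow> real^3" where
  "facet_normal S = (THE a. \<forall>x\<in>S. x \<bullet> a = 1)"

definition realization_of :: "(real^3) set \<Rightarrow> (real^3, (real^3) set) realization" where
  "realization_of P =
    (restrict (\<lambda>v. v) (verts (comb_type_of P)),
     restrict facet_normal (facets (comb_type_of P)))"

definition motion_of :: "(real^3) set \<Rightarrow> (real \<Rightarrow> (real^3, (real^3) set) realization) \<Rightarrow> bool" where
  "motion_of P g \<longleftrightarrow>
    path g \<and> path_image g \<subseteq> REAL (comb_type_of P) \<and> pathstart g = realization_of P \<and>
    (\<forall>t\<in>{0..1}. edge_equivalent (comb_type_of P) (g t) (realization_of P))"

definition trivial_motion_of ::
  "(real^3) set \<Rightarrow> (real \<Rightarrow> (real^3, (real^3) set) realization) \<Rightarrow> bool" where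
  "trivial_motion_of P g \<longleftrightarrow>
    (\<forall>t\<in>{0..1}. vertex_congruent (comb_type_of P) (g t) (realization_of P))"

definition rigid_polytope :: "(real^3) set \<Rightarrow> bool" where
  "rigid_polytope P \<longleftrightarrow> (\<forall>g. motion_of P g \<longrightarrow> trivial_motion_of P g)"

end

theory Submission imports Defs begin

text \<open>The dodecahedron is not infinitesimally rigid: modulo isometries its infinitesimal flexes form a 5-dimensional
  space, and so do its self-stresses. Each self-stress annihilates the linear part of the constraints (all of which
  are quadratic), hence gives a quadratic form that vanishes on all differences of realizations with
  the same edge lengths. If non-congruent realizations accumulated at the dodecahedron, their differences to it,
  normalized and with isometries factored out, would accumulate at a nonzero infinitesimal flex
  on which all five quadratic forms vanish. In coordinates adapted to the sign changes and the cyclic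
  permutation of the axes the flexes and the forms are sparse, and the forms have no common
  real zero besides \<open>0\<close>. So the realizations congruent to the dodecahedron form an open and closed subset of every motion.\<close>

section \<open>Linear systems for the infinitesimal flexes\<close>

text \<open>There are \<open>3 * 20 + 3 * 12 = 96\<close> coordinates of vertices and facet normals,
  against 60 incidences and 30 edge lengths. Modulo the 6 dimensions of isometries the linearization
  is square, so nontrivial flexes and self-stresses have equal dimension, and linear algebra alone
  does not decide rigidity.

  Keeping the normals as unknowns makes every constraint exactly quadratic: a difference to the
  dodecahedron, rescaled by its size h, satisfies (linear) + h * (quadratic) = 0 without remainder.
  A self-stress turns this into h * (form) = 0, and dividing by h before the limit avoids
  second-order flexes and analytic arcs.

  Under the group of order 24 generated by the sign changes and the rotation of the axes, the flexes
  split as 2 + 3: parameters \<open>e1, e2, e3\<close> with sum 0, and one parameter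
  \<open>x\<close>, \<open>y\<close>, \<open>z\<close> per axis.

  Realizations refer to a fixed origin, and a translation acts nonlinearly on the normals;
  recentring a realization therefore has to rescale them.\<close>

lemma golden_ratio_simp: "(p::real) * p = p + 1 \<Longrightarrow> p * (p * x) = p * x + x"
  by (metis distrib_right mult.assoc mult_1)

text \<open>The linearized constraints split according to the characters of the group of sign changes. Up to the cyclic
  symmetry there are four systems: that of the character \<open>r * s * t\<close>, the invariant one, the one
  containing the infinitesimal rotation about the first axis, and the one containing the translation along it.\<close>

lemma block_odd:
  fixes p :: real
  assumes p: "p * p = p + 1"
    and XA: "X1 + (2-p)*A2 + (p-1)*A3 = 0"
    and XC: "(p-1)*X1 + (2-p)*C2 = 0"
    and YA: "Y2 + (2-p)*A3 + (p-1)*A1 = 0"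
    and YD: "(p-1)*Y2 + (2-p)*D3 = 0"
    and ZA: "Z3 + (2-p)*A1 + (p-1)*A2 = 0"
    and ZB: "(p-1)*Z3 + (2-p)*B1 = 0"
    and AB: "A1 - B1 + (1-p)*A2 + (2-p)*A3 = 0"
    and AC: "A2 - C2 + (1-p)*A3 + (2-p)*A1 = 0"
    and AD: "A3 - D3 + (1-p)*A1 + (2-p)*A2 = 0"
  shows "A1 = 0" "A2 = 0" "A3 = 0" "B1 = 0" "C2 = 0" "D3 = 0" "X1 = 0" "Y2 = 0" "Z3 = 0"
proof -
  have C2: "C2 = (p-1)*A2 + A3" using p XA XC by algebra
  have D3: "D3 = (p-1)*A3 + A1" using p YA YD by algebra
  have B1: "B1 = (p-1)*A1 + A2" using p ZA ZB by algebra
  \<comment> \<open>The edge equations make \<open>A1\<close>, \<open>A2\<close>, \<open>A3\<close>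
    equal to a common \<open>A\<close> with \<open>3 * (2-p) * A = 2 * A\<close>, that is
    \<open>(4 - 3*p) * A = 0\<close>; and \<open>4/3\<close> is no root of
    \<open>p * p = p + 1\<close>.\<close>
  have "(2-p)*(A1+A2+A3) = 2*A2" using p AB B1 by algebra
  moreover have "(2-p)*(A1+A2+A3) = 2*A3" using p AC C2 by algebra
  moreover have "(2-p)*(A1+A2+A3) = 2*A1" using p AD D3 by algebra
  ultimately show "A1 = 0" "A2 = 0" "A3 = 0" using p by algebra+
  with B1 C2 D3 XA YA ZA show "B1 = 0" "C2 = 0" "D3 = 0" "X1 = 0" "Y2 = 0" "Z3 = 0" by simp_all
qed

text \<open>A name such as \<open>XA\<close> stands for the incidences of the facets
  \<open>X\<close> with the vertices \<open>A\<close>, and \<open>AB\<close> for the edges between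
  \<open>A\<close> and \<open>B\<close>; digits are coordinates. The three hypotheses
  \<open>0\<close> come from the edges inside the families \<open>B\<close>, \<open>C\<close>,
  \<open>D\<close>. After elimination, \<open>XB\<close> forces the zero sum and two parameters
  remain.\<close>

lemma block_invariant:
  fixes p :: real
  assumes p: "p * p = p + 1"
    and XA: "(2-p)*A2 + X2 + (p-1)*A3 + X3 = 0"
    and XB: "(2-p)*B2 + p*X2 + (p-1)*B3 + (p-1)*X3 = 0"
    and XC: "(p-1)*C3 + p*X3 = 0"
    and YA: "(2-p)*A3 + Y3 + (p-1)*A1 + Y1 = 0"
    and YD: "(p-1)*D1 + p*Y1 = 0"
    and ZA: "(2-p)*A1 + Z1 + (p-1)*A2 + Z2 = 0"
    and ZB: "(p-1)*B2 + p*Z2 = 0"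
    and AB: "A1 + (1-p)*(A2-B2) + (2-p)*(A3-B3) = 0"
    and AC: "A2 + (1-p)*(A3-C3) + (2-p)*(A1-C1) = 0"
    and AD: "A3 + (1-p)*(A1-D1) + (2-p)*(A2-D2) = 0"
    and 0: "B3 = 0" "C1 = 0" "D2 = 0"
  shows "A1 + A2 + A3 = 0" 
    and "B2 = p*A2 - A1" "C3 = p*A3 - A2" "D1 = p*A1 - A3"
    and "X2 = 2*(p-2)*A2" "X3 = (1-p)*A3+(2-p)*A2"
    and "Y3 = 2*(p-2)*A3" "Y1 = (1-p)*A1+(2-p)*A3"
    and "Z1 = 2*(p-2)*A1" "Z2 = (1-p)*A2+(2-p)*A1"
proof -
  have X3: "X3 = (p-2)*C3" using p XC by algebra
  have Y1: "Y1 = (p-2)*D1" using p YD by algebra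
  have Z2: "Z2 = (p-2)*B2" using p ZB by algebra
  have B2: "B2 = A2 - p*A1 - (p-1)*A3" using p AB[unfolded 0] by algebra
  have C3: "C3 = A3 - p*A2 - (p-1)*A1" using p AC[unfolded 0] by algebra
  have D1: "D1 = A1 - p*A3 - (p-1)*A2" using p AD[unfolded 0] by algebra
  have X2: "X2 = (p-2)*A2 + (1-p)*A3 - (p-2)*(A3 - p*A2 - (p-1)*A1)" using XA X3 C3 by algebra
  show S: "A1 + A2 + A3 = 0" using XB[unfolded 0 B2 X2 X3 C3] p by algebra
  then have A3: "A3 = -A1-A2" by simp
  show B: "B2 = p*A2 - A1" using B2 S p by algebra
  show C: "C3 = p*A3 - A2" using C3 S p by algebra
  show D: "D1 = p*A1 - A3" using D1 S p by algebra
  show "X2 = 2*(p-2)*A2" using X2 S p by algebra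
  show "X3 = (1-p)*A3+(2-p)*A2" using X3 C p by algebra
  then show "Y3 = 2*(p-2)*A3" using p YA Y1 D by algebra
  show "Y1 = (1-p)*A1+(2-p)*A3" using Y1 D p by algebra
  show "Z1 = 2*(p-2)*A1" using p ZA Z2 B by algebra
  show "Z2 = (1-p)*A2+(2-p)*A1" using p Z2 B by algebra
qed

text \<open>The other equations leave two parameters, for a flex and for the rotation about the
  first axis; \<open>gauge\<close> is orthogonality to that rotation. Its factor 2 arises because
  the unknowns are sums over all eight sign choices, which meet each vertex \<open>A\<close> once
  and each vertex \<open>B\<close>, \<open>C\<close>, \<open>D\<close> twice.\<close>

lemma block_rotational:
  fixes p :: real
  assumes p: "p * p = p + 1"
    and XA: "(2-p)*A2 + X2 + (p-1)*A3 + X3 = 0"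
    and XC: "(2-p)*C2 + p*X3 = 0"
    and YA: "(p-1)*A1 + Y2 + (2-p)*A3 = 0"
    and YD: "(p-1)*Y2 + (2-p)*D3 = 0"
    and ZA: "(2-p)*A1 + (p-1)*A2 + Z3 = 0"
    and ZB: "(p-1)*B2 + (p-1)*Z3 = 0"
    and AB: "A1 + (1-p)*(A2-B2) + (2-p)*(A3-B3) = 0"
    and AC: "(2-p)*A1 + A2 - C2 + (1-p)*A3 = 0"
    and AD: "(1-p)*A1 + (2-p)*A2 + A3 - D3 = 0"
    and gauge: "2*(A2 - A3) + (p-1)*B2 - p*B3 + p*C2 - (p-1)*D3 = 0"
  shows "A2 = (p+1)*A1" "A3 = p*A1" "B2 = 2*A1" "B3 = 2*p*A1" "C2 = 2*A1" "D3 = 2*A1"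
    and "X2 = 4*(p-2)*A1" "X3 = 2*(3-2*p)*A1" "Y2 = 2*(1-p)*A1" "Z3 = -2*A1"
proof -
  have Z3: "Z3 = (p-2)*A1 + (1-p)*A2" using ZA by algebra
  have B2: "B2 = (2-p)*A1 + (p-1)*A2" using p ZB Z3 by algebra
  have Y2: "Y2 = (1-p)*A1 + (p-2)*A3" using YA by algebra
  have D3: "D3 = A1 + (p-1)*A3" using YD Y2 p by algebra
  have A2: "A2 = (2*p+1)*A1 - A3" using AD D3 p by algebra
  have C2: "C2 = (p+3)*A1 - p*A3" using AC A2 p by algebra
  have X3: "X3 = (3-2*p)*((p+3)*A1 - p*A3)" using XC C2 p by algebra
  have B3: "B3 = p*A3 + (p-1)*A1" using AB B2 A2 p by algebra
  show A3: "A3 = p*A1" using gauge[unfolded B2 B3 C2 D3 A2] p by algebra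
  show A2: "A2 = (p+1)*A1" using A2 A3 by algebra
  show "B2 = 2*A1" using B2 A2 p by algebra
  show "B3 = 2*p*A1" using B3 A3 p by algebra
  show "C2 = 2*A1" using C2 A3 p by algebra
  show "D3 = 2*A1" using D3 A3 p by algebra
  show "X3 = 2*(3-2*p)*A1" using X3 A3 p by algebra
  then show "X2 = 4*(p-2)*A1" using XA A2 A3 p by algebra
  show "Y2 = 2*(1-p)*A1" using Y2 A3 p by algebra
  show "Z3 = -2*A1" using Z3 A2 p by algebra
qed

text \<open>Without \<open>gauge\<close> exactly one parameter remains, the translation along the
  first axis; \<open>gauge\<close> keeps the centroid of the vertices fixed.\<close>

lemma block_translational:
  fixes p :: real
  assumes p: "p * p = p + 1"
    and XA: "X1 + (2-p)*A2 + (p-1)*A3 = 0"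
    and XC: "(p-1)*X1 + (p-1)*C3 = 0"
    and YA: "(p-1)*A1 + Y1 + (2-p)*A3+Y3 = 0"
    and YC: "(p-1)*C1 + (p-1)*Y1 + (2-p)*C3 + p*Y3 = 0"
    and YD: "(p-1)*D1 + p * Y1 = 0"
    and ZA: "(2-p)*A1 + Z1 + (p-1)*A2 + Z2 = 0"
    and ZD: "(2-p)*D1 + p*Z1 + (p-1)*D2 + (p-1)*Z2 = 0"
    and ZB: "(2-p)*B1 + p*Z2 = 0"
    and AB: "A1 - B1 + (1-p)*A2 + (2-p)*A3 = 0"
    and AC: "(2-p)*(A1-C1) + A2 + (1-p)*(A3-C3) = 0"
    and AD: "(1-p)*(A1-D1) + (2-p)*(A2-D2) + A3 = 0"
    and D2: "D2 = 0" and gauge: "2*A1+B1+C1+D1 = 0"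
  shows "A1 = 0" "A2 = 0" "A3 = 0" "B1 = 0" "C1 = 0" "C3 = 0" "D1 = 0"
    and "X1 = 0" "Y1 = 0" "Y3 = 0" "Z1 = 0" "Z2 = 0" 
proof -
  have X1: "X1 = (p-2)*A2 + (1-p)*A3" using XA by algebra
  have C3: "C3 = (2-p)*A2 + (p-1)*A3" using X1 XC p by algebra
  have B1: "B1 = A1 + (1-p)*A2 + (2-p)*A3" using AB by algebra
  have Z2: "Z2 = (3-2*p)*B1" using ZB p by algebra
  have D1: "D1 = A1 + (1-p)*A2 - p*A3" using AD[unfolded D2] p by algebra
  have Y1: "Y1 = (p-2)*D1" using YD p by algebra
  have A2: "A2 = (p-2)*A3" using ZD[unfolded D2] ZA Z2 D1 B1 p by algebra
  have C1: "C1 = A1 + (p+1)*A2 - p*(A3-C3)" using AC p by algebra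
  show A3: "A3 = 0" using YC YA Y1 D1 C1 C3 A2 p by algebra
  show A2: "A2 = 0" using A2 A3 by simp
  note [simp] = A2 A3
  have "B1 = A1" "C3 = 0" "D1 = A1" "X1 = 0" using B1 C3 D1 X1 by simp_all
  moreover have "C1 = A1" using C1 \<open>C3 = 0\<close> by simp
  ultimately show "A1 = 0" "B1 = 0" "C3 = 0" "D1 = 0" "X1 = 0" "C1 = 0" using gauge by simp_all
  then show "Z2 = 0" "Y1 = 0" "Y3 = 0" "Z1 = 0" using Z2 Y1 YA ZA by simp_all
qed

section \<open>Flexes of the dodecahedron\<close>

definition phi :: real where "phi = (1 + sqrt 5) / 2"

lemma phi_sq: "phi * phi = phi + 1"
  by (simp add: phi_def field_simps)

lemmas phi_simps = phi_sq golden_ratio_simp[OF phi_sq]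

lemma phi_bounds: "phi > 1.618" "phi < 1.6181"
proof -
  have "sqrt 5 > 2.236" by (rule real_less_rsqrt) (simp add: power2_eq_square)
  moreover have "sqrt 5 < 2.2362" by (rule real_less_lsqrt) (simp_all add: power2_eq_square)
  ultimately show "phi > 1.618" "phi < 1.6181" by (auto simp: phi_def)
qed

lemma sqrt5_phi: "sqrt 5 = 2 * phi - 1"
  by (simp add: phi_def field_simps)

section \<open>Vertices and facet normals in coordinates\<close>

definition signs :: "real set" where "signs = {1, -1}"

lemma signs_simps [simp]:
  "1 \<in> signs" "-1 \<in> signs" "- s \<in> signs \<longleftrightarrow> s \<in> signs" "finite signs"
  "s \<in> signs \<Longrightarrow> s * s = 1" "s \<in> signs \<Longrightarrow> s * (s * x) = x" "s \<in> signs \<Longrightarrow> s \<noteq> 0"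
  by (auto simp: signs_def)

lemma sum_signs: "sum f signs = f 1 + f (-1)"
  by (simp add: signs_def)

text \<open>With \<open>1/phi = phi - 1\<close> and \<open>1/phi\<^sup>2 = 2 - phi\<close>. The arguments are ordered so that, for all signs
  \<open>r, s, t\<close>, the vertex \<open>vA r s t\<close> is adjacent to \<open>vB s t\<close>, \<open>vC t r\<close>, \<open>vD r s\<close> and lies on the facets
  with normals \<open>nX s t\<close>, \<open>nY t r\<close>, \<open>nZ r s\<close>, and the rotation of the coordinate axes permutes
  \<open>vB, vC, vD\<close> and \<open>nX, nY, nZ\<close>.\<close>

definition vA :: "real \<Rightarrow> real \<Rightarrow> real \<Rightarrow> real^3" where "vA r s t = vector [r, s, t]"
definition vB :: "real \<Rightarrow> real \<Rightarrow> real^3" where "vB s t = vector [0, s * phi, t * (phi - 1)]"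
definition vC :: "real \<Rightarrow> real \<Rightarrow> real^3" where "vC t r = vector [r * (phi - 1), 0, t * phi]"
definition vD :: "real \<Rightarrow> real \<Rightarrow> real^3" where "vD r s = vector [r * phi, s * (phi - 1), 0]"
definition nX :: "real \<Rightarrow> real \<Rightarrow> real^3" where "nX s t = vector [0, s * (2 - phi), t * (phi - 1)]"
definition nY :: "real \<Rightarrow> real \<Rightarrow> real^3" where "nY t r = vector [r * (phi - 1), 0, t * (2 - phi)]"
definition nZ :: "real \<Rightarrow> real \<Rightarrow> real^3" where "nZ r s = vector [r * (2 - phi), s * (phi - 1), 0]"

lemmas point_defs = vA_def vB_def vC_def vD_def nX_def nY_def nZ_def

lemma inner_3: "(x::real^3) \<bullet> y = x$1 * y$1 + x$2 * y$2 + x$3 * y$3"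
  by (simp add: inner_vec_def sum_3)

definition dverts :: "(real^3) set" where
  "dverts = (\<lambda>(r,s,t). vA r s t) ` (signs \<times> signs \<times> signs) \<union> (\<lambda>(s,t). vB s t) ` (signs \<times> signs) \<union>
    (\<lambda>(t,r). vC t r) ` (signs \<times> signs) \<union> (\<lambda>(r,s). vD r s) ` (signs \<times> signs)"

definition dnormals :: "(real^3) set" where
  "dnormals = (\<lambda>(s,t). nX s t) ` (signs \<times> signs) \<union> (\<lambda>(t,r). nY t r) ` (signs \<times> signs) \<union>
    (\<lambda>(r,s). nZ r s) ` (signs \<times> signs)"

lemma dvertsI [intro, simp]:
  "r \<in> signs \<Longrightarrow> s \<in> signs \<Longrightarrow> t \<in> signs \<Longrightarrow> vA r s t \<in> dverts"
  "s \<in> signs \<Longrightarrow> t \<in> signs \<Longrightarrow> vB s t \<in> dverts"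
  "t \<in> signs \<Longrightarrow> r \<in> signs \<Longrightarrow> vC t r \<in> dverts"
  "r \<in> signs \<Longrightarrow> s \<in> signs \<Longrightarrow> vD r s \<in> dverts"
  unfolding dverts_def by force+

lemma dnormalsI [intro, simp]:
  "s \<in> signs \<Longrightarrow> t \<in> signs \<Longrightarrow> nX s t \<in> dnormals"
  "t \<in> signs \<Longrightarrow> r \<in> signs \<Longrightarrow> nY t r \<in> dnormals"
  "r \<in> signs \<Longrightarrow> s \<in> signs \<Longrightarrow> nZ r s \<in> dnormals"
  unfolding dnormals_def by force+

lemma dverts_cases [elim?]:
  assumes "v \<in> dverts"
  obtains (A) r s t where "v = vA r s t" "r \<in> signs" "s \<in> signs" "t \<in> signs"
    | (B) s t where "v = vB s t" "s \<in> signs" "t \<in> signs"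
    | (C) t r where "v = vC t r" "t \<in> signs" "r \<in> signs"
    | (D) r s where "v = vD r s" "r \<in> signs" "s \<in> signs"
  using assms unfolding dverts_def by auto

lemma dnormals_cases [elim?]:
  assumes "n \<in> dnormals"
  obtains (X) s t where "n = nX s t" "s \<in> signs" "t \<in> signs"
    | (Y) t r where "n = nY t r" "t \<in> signs" "r \<in> signs"
    | (Z) r s where "n = nZ r s" "r \<in> signs" "s \<in> signs"
  using assms unfolding dnormals_def by auto

lemma finite_dverts [simp]: "finite dverts" and finite_dnormals [simp]: "finite dnormals"
  by (simp_all add: dverts_def dnormals_def)

lemma incidences:
  assumes "r \<in> signs" "s \<in> signs" "t \<in> signs"
  shows "vA r s t \<bullet> nX s t = 1" "vB s t \<bullet> nX s t = 1" "vC t r \<bullet> nX s t = 1"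
    "vA r s t \<bullet> nY t r = 1" "vC t r \<bullet> nY t r = 1" "vD r s \<bullet> nY t r = 1"
    "vA r s t \<bullet> nZ r s = 1" "vD r s \<bullet> nZ r s = 1" "vB s t \<bullet> nZ r s = 1"
  using assms by (simp_all add: point_defs inner_3 algebra_simps phi_simps)

text \<open>Inner product \<open>sqrt 5\<close> serves as the test for adjacency: all vertices have
  squared norm 3, and \<open>sqrt 5 = 2 * phi - 1\<close> is the largest inner product of two
  distinct ones. The families contain 8 + 8 + 8 + 2 + 2 + 2 = 30 edges.\<close>

lemma adjacencies:
  assumes "r \<in> signs" "s \<in> signs" "t \<in> signs"
  shows "vA r s t \<bullet> vB s t = sqrt 5" "vA r s t \<bullet> vC t r = sqrt 5" "vA r s t \<bullet> vD r s = sqrt 5"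
    "vB s t \<bullet> vB s (-t) = sqrt 5" "vC t r \<bullet> vC t (-r) = sqrt 5" "vD r s \<bullet> vD r (-s) = sqrt 5"
  using assms by (simp_all add: point_defs inner_3 algebra_simps phi_simps sqrt5_phi)

text \<open>\<open>w\<close> and \<open>b\<close> are the increments of vertices and facet normals, divided by \<open>h\<close>:
  then \<open>h = 1\<close> gives the exact constraints and \<open>h = 0\<close> their linearization.\<close>

definition flex_at :: "real \<Rightarrow> (real^3 \<Rightarrow> real^3) \<Rightarrow> (real^3 \<Rightarrow> real^3) \<Rightarrow> bool" where
  "flex_at h w b \<longleftrightarrow>
    (\<forall>v\<in>dverts. \<forall>n\<in>dnormals. v \<bullet> n = 1 \<longrightarrow> w v \<bullet> n + v \<bullet> b n + h * (w v \<bullet> b n) = 0) \<and>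
    (\<forall>v\<in>dverts. \<forall>v'\<in>dverts. v \<bullet> v' = sqrt 5 \<longrightarrow>
       (v - v') \<bullet> (w v - w v') + h * ((w v - w v') \<bullet> (w v - w v') / 2) = 0)"

section \<open>The cyclic rotation of the axes\<close>

definition cyc :: "real^3 \<Rightarrow> real^3" where "cyc v = vector [v$2, v$3, v$1]"
definition cyc_inv :: "real^3 \<Rightarrow> real^3" where "cyc_inv v = vector [v$3, v$1, v$2]"

lemma cyc_nth [simp]: "cyc v $ 1 = v $ 2" "cyc v $ 2 = v $ 3" "cyc v $ 3 = v $ 1"
  by (simp_all add: cyc_def)
lemma cyc_inv_nth [simp]: "cyc_inv v $ 1 = v $ 3" "cyc_inv v $ 2 = v $ 1" "cyc_inv v $ 3 = v $ 2"
  by (simp_all add: cyc_inv_def)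

lemma cyc_cyc_inv [simp]: "cyc (cyc_inv v) = v" "cyc_inv (cyc v) = v"
  by (simp_all add: vec_eq_iff forall_3)

lemma cyc_inner [simp]: "cyc v \<bullet> cyc w = v \<bullet> w" "cyc_inv v \<bullet> cyc_inv w = v \<bullet> w"
  by (simp_all add: inner_3)

lemma cyc_linear: "linear cyc"
  by (rule linearI) (simp_all add: vec_eq_iff forall_3)

lemma cyc_inv_points [simp]:
  "cyc_inv (vA r s t) = vA t r s" "cyc_inv (vB s t) = vC s t" "cyc_inv (vC s t) = vD s t"
  "cyc_inv (vD s t) = vB s t" "cyc_inv (nX s t) = nY s t" "cyc_inv (nY s t) = nZ s t"
  "cyc_inv (nZ s t) = nX s t"
  by (simp_all add: vec_eq_iff forall_3 point_defs)

lemma cyc_points [simp]: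
  "cyc (vA r s t) = vA s t r" "cyc (vB s t) = vD s t" "cyc (vC s t) = vB s t"
  "cyc (vD s t) = vC s t" "cyc (nX s t) = nZ s t" "cyc (nY s t) = nX s t"
  "cyc (nZ s t) = nY s t"
  by (simp_all add: vec_eq_iff forall_3 point_defs)

lemma cyc_inv_dverts: "v \<in> dverts \<Longrightarrow> cyc_inv v \<in> dverts" and cyc_dverts: "v \<in> dverts \<Longrightarrow> cyc v \<in> dverts"
  by (auto elim!: dverts_cases)
lemma cyc_inv_dnormals: "n \<in> dnormals \<Longrightarrow> cyc_inv n \<in> dnormals"
  by (auto elim!: dnormals_cases)

text \<open>The action of the rotation on vector fields. The second and third coordinates of
  \<open>w\<close> are first coordinates of its two rotated copies, so that it suffices to study
  first coordinates.\<close>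

definition conj_cyc :: "(real^3 \<Rightarrow> real^3) \<Rightarrow> real^3 \<Rightarrow> real^3" where
  "conj_cyc w v = cyc (w (cyc_inv v))"

lemma flex_at_cyc:
  assumes "flex_at h w b"
  shows "flex_at h (conj_cyc w) (conj_cyc b)"
proof -
  interpret linear cyc by (rule cyc_linear)
  have *: "v \<bullet> cyc y = cyc_inv v \<bullet> y" "cyc y \<bullet> v = y \<bullet> cyc_inv v" for v y
    by (simp_all add: inner_3)
  have **: "cyc_inv (v - v') = cyc_inv v - cyc_inv v'" for v v'
    by (simp add: vec_eq_iff forall_3)
  show ?thesis
    unfolding flex_at_def conj_cyc_def
  proof (intro conjI ballI impI)
    fix v n assume "v \<in> dverts" "n \<in> dnormals" "v \<bullet> n = 1"
    then have "cyc_inv v \<in> dverts" "cyc_inv n \<in> dnormals" "cyc_inv v \<bullet> cyc_inv n = 1"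
      by (simp_all add: cyc_inv_dverts cyc_inv_dnormals)
    then show "cyc (w (cyc_inv v)) \<bullet> n + v \<bullet> cyc (b (cyc_inv n)) +
        h * (cyc (w (cyc_inv v)) \<bullet> cyc (b (cyc_inv n))) = 0"
      using assms unfolding flex_at_def by (simp add: *)
  next
    fix v v' assume "v \<in> dverts" "v' \<in> dverts" "v \<bullet> v' = sqrt 5"
    then have "cyc_inv v \<in> dverts" "cyc_inv v' \<in> dverts" "cyc_inv v \<bullet> cyc_inv v' = sqrt 5"
      by (simp_all add: cyc_inv_dverts)
    then show "(v - v') \<bullet> (cyc (w (cyc_inv v)) - cyc (w (cyc_inv v'))) + h *
        ((cyc (w (cyc_inv v)) - cyc (w (cyc_inv v'))) \<bullet> (cyc (w (cyc_inv v)) - cyc (w (cyc_inv v'))) / 2) = 0"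
      using assms unfolding flex_at_def by (simp add: * ** flip: diff)
  qed
qed

text \<open>Orthogonality to the infinitesimal isometries.\<close>

definition gauged :: "(real^3 \<Rightarrow> real^3) \<Rightarrow> bool" where
  "gauged w \<longleftrightarrow> (\<Sum>v\<in>dverts. w v) = 0 \<and> (\<Sum>v\<in>dverts. cross3 (w v) v) = 0"

lemma sum_dverts: "(\<Sum>v\<in>dverts. f v) = (\<Sum>r\<in>signs. \<Sum>s\<in>signs. \<Sum>t\<in>signs. f (vA r s t)) +
   (\<Sum>s\<in>signs. \<Sum>t\<in>signs. f (vB s t)) + (\<Sum>t\<in>signs. \<Sum>r\<in>signs. f (vC t r)) +
   (\<Sum>r\<in>signs. \<Sum>s\<in>signs. f (vD r s))"
proof -
  let ?A = "(\<lambda>(r,s,t). vA r s t) ` (signs \<times> signs \<times> signs)"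
  let ?B = "(\<lambda>(s,t). vB s t) ` (signs \<times> signs)"
  let ?C = "(\<lambda>(t,r). vC t r) ` (signs \<times> signs)"
  let ?D = "(\<lambda>(r,s). vD r s) ` (signs \<times> signs)"
  note [simp] = vec_eq_iff[where 'b="3"] forall_3 point_defs
  have "phi \<noteq> 0" "phi \<noteq> 1" using phi_bounds by auto
  then have "?A \<inter> ?B = {}" "(?A \<union> ?B) \<inter> ?C = {}" "((?A \<union> ?B) \<union> ?C) \<inter> ?D = {}"
    and "inj_on (\<lambda>(r,s,t). vA r s t) (signs \<times> signs \<times> signs)"
     "inj_on (\<lambda>(s,t). vB s t) (signs \<times> signs)"
     "inj_on (\<lambda>(t,r). vC t r) (signs \<times> signs)"
     "inj_on (\<lambda>(r,s). vD r s) (signs \<times> signs)"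
    by (auto simp: inj_on_def)
  then show ?thesis
    unfolding dverts_def
    by (simp add: sum.union_disjoint sum.reindex sum.cartesian_product comp_def case_prod_unfold del: vec_eq_iff point_defs)
qed

lemma gauged_cyc:
  assumes "gauged w" shows "gauged (conj_cyc w)"
proof -
  interpret linear cyc by (rule cyc_linear)
  have b: "bij_betw cyc_inv dverts dverts"
    by (rule bij_betwI[of _ _ _ cyc]) (auto simp: cyc_inv_dverts cyc_dverts)
  have "(\<Sum>v\<in>dverts. conj_cyc w v) = cyc (\<Sum>v\<in>dverts. w v)"
    unfolding conj_cyc_def sum by (rule sum.reindex_bij_betw[OF b])
  moreover have "cross3 (cyc x) v = cyc (cross3 x (cyc_inv v))" for x v
    by (simp add: vec_eq_iff forall_3 cross3_simps)
  then have "(\<Sum>v\<in>dverts. cross3 (conj_cyc w v) v) = cyc (\<Sum>v\<in>dverts. cross3 (w v) v)"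
    unfolding conj_cyc_def sum using sum.reindex_bij_betw[OF b, of "\<lambda>v. cyc (cross3 (w v) v)"] by simp
  ultimately show ?thesis using assms by (simp add: gauged_def zero)
qed

section \<open>Self-stresses\<close>

text \<open>A sum over the group of sign changes. With a character as a factor it is a Fourier
  coefficient; using it for the smaller vertex orbits too, with repetitions, treats all orbits
  alike.\<close>

definition sum3 :: "(real \<Rightarrow> real \<Rightarrow> real \<Rightarrow> real) \<Rightarrow> real" where
  "sum3 f = (\<Sum>r\<in>signs. \<Sum>s\<in>signs. \<Sum>t\<in>signs. f r s t)"

lemma sum3_expand: "sum3 f = f 1 1 1 + f 1 1 (-1) + f 1 (-1) 1 + f 1 (-1) (-1) +
    f (-1) 1 1 + f (-1) 1 (-1) + f (-1) (-1) 1 + f (-1) (-1) (-1)"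
  by (simp add: sum3_def sum_signs)

lemma sum3_add: "sum3 (\<lambda>r s t. f r s t + g r s t) = sum3 f + sum3 g"
  by (simp add: sum3_def sum.distrib)

lemma sum3_cmult: "sum3 (\<lambda>r s t. c * f r s t) = c * sum3 f"
  by (simp add: sum3_def sum_distrib_left)

lemma flex_at_inc: "flex_at h w b \<Longrightarrow> v \<in> dverts \<Longrightarrow> n \<in> dnormals \<Longrightarrow> v \<bullet> n = 1 \<Longrightarrow>
    w v \<bullet> n + v \<bullet> b n + h * (w v \<bullet> b n) = 0"
  by (simp add: flex_at_def)

lemma flex_at_edge: "flex_at h w b \<Longrightarrow> v \<in> dverts \<Longrightarrow> v' \<in> dverts \<Longrightarrow> v \<bullet> v' = sqrt 5 \<Longrightarrow>
    (v - v') \<bullet> (w v - w v') + h * ((w v - w v') \<bullet> (w v - w v') / 2) = 0"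
  by (simp add: flex_at_def)

text \<open>Two self-stresses, evaluated on functions \<open>f\<close> of incidences and \<open>g\<close> of edges: the first one changes sign like
  \<open>s * t\<close> under the reflections in the coordinate planes, the second one is invariant under them. The weights solve the
  equilibrium equations; weights on orbits of size 4 (2) are halved (quartered),
  because \<open>sum3\<close> counts these orbits twice (four times). Together with their images under the cyclic
  rotation these span the 5-dimensional space of self-stresses.\<close>

definition stress_x :: "(real^3 \<Rightarrow> real^3 \<Rightarrow> real) \<Rightarrow> (real^3 \<Rightarrow> real^3 \<Rightarrow> real) \<Rightarrow> real" where
  "stress_x f g = sum3 (\<lambda>r s t. s * t * (
      f (vA r s t) (nX s t) + (1 - phi) * f (vB s t) (nX s t) + (phi - 2) * f (vC t r) (nX s t)
      + (3 - phi) * f (vA r s t) (nY t r) + (1 - 2*phi) * f (vD r s) (nY t r)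
      + (4 - 3*phi) * f (vA r s t) (nZ r s) + (3 - phi) * f (vB s t) (nZ r s)
      - g (vA r s t) (vB s t) + (3*phi - 5) * g (vA r s t) (vC t r) + (4 - 3*phi) * g (vA r s t) (vD r s)))"

definition stress_e :: "(real^3 \<Rightarrow> real^3 \<Rightarrow> real) \<Rightarrow> (real^3 \<Rightarrow> real^3 \<Rightarrow> real) \<Rightarrow> real" where
  "stress_e f g = sum3 (\<lambda>r s t.
      f (vA r s t) (nX s t) + (1 - phi) * f (vB s t) (nX s t) + (phi - 2) * f (vC t r) (nX s t)
      - f (vA r s t) (nZ r s) + (phi - 1) * f (vD r s) (nZ r s) + (2 - phi) * f (vB s t) (nZ r s)
      + (2 - phi) * g (vA r s t) (vC t r) + (phi - 2) * g (vA r s t) (vD r s)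
      + (phi - 1) / 4 * g (vB s t) (vB s (-t)) + (2*phi - 3) / 4 * g (vC t r) (vC t (-r))
      + (4 - 3*phi) / 4 * g (vD r s) (vD r (-s)))"

text \<open>Holding for arbitrary \<open>w\<close> and \<open>b\<close>, this says that the
  coefficient of every coordinate of every \<open>w v\<close> and \<open>b n\<close> cancels, which
  is what makes the weights a self-stress.\<close>

lemma stress_x_equilibrium:
  "stress_x (\<lambda>v n. w v \<bullet> n + v \<bullet> b n) (\<lambda>v v'. (v - v') \<bullet> (w v - w v')) = 0"
  unfolding stress_x_def sum3_expand
  by (simp add: inner_3 point_defs algebra_simps phi_simps)

lemma stress_e_equilibrium:
  "stress_e (\<lambda>v n. w v \<bullet> n + v \<bullet> b n) (\<lambda>v v'. (v - v') \<bullet> (w v - w v')) = 0"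
  unfolding stress_e_def sum3_expand
  by (simp add: inner_3 point_defs algebra_simps phi_simps)

lemma stress_linear:
  "stress_x (\<lambda>v n. f v n + h * f' v n) (\<lambda>v v'. g v v' + h * g' v v') = stress_x f g + h * stress_x f' g'"
  "stress_e (\<lambda>v n. f v n + h * f' v n) (\<lambda>v v'. g v v' + h * g' v v') = stress_e f g + h * stress_e f' g'"
  unfolding stress_x_def stress_e_def
  by (simp_all flip: sum3_cmult sum3_add add: algebra_simps)

lemma sum3_zero: "(\<And>r s t. r \<in> signs \<Longrightarrow> s \<in> signs \<Longrightarrow> t \<in> signs \<Longrightarrow> f r s t = 0) \<Longrightarrow> sum3 f = 0"
  by (simp add: sum3_def)

definition stress_forms_vanish :: "(real^3 \<Rightarrow> real^3) \<Rightarrow> (real^3 \<Rightarrow> real^3) \<Rightarrow> bool" where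
  "stress_forms_vanish w b \<longleftrightarrow> (let f = \<lambda>v n. w v \<bullet> b n; g = \<lambda>v v'. (w v - w v') \<bullet> (w v - w v') / 2 in
    stress_x f g = 0 \<and> stress_e f g = 0)"

text \<open>The stress kills the linear part of the constraints and leaves \<open>h\<close> times
  the quadratic form, which may be divided by \<open>h\<close>.\<close>

lemma flex_at_stress_forms_vanish:
  assumes "flex_at h w b" "h \<noteq> 0"
  shows "stress_forms_vanish w b"
proof -
  let ?f = "\<lambda>v n. w v \<bullet> n + v \<bullet> b n + h * (w v \<bullet> b n)"
  let ?g = "\<lambda>v v'. (v - v') \<bullet> (w v - w v') + h * ((w v - w v') \<bullet> (w v - w v') / 2)"
  have "stress_x ?f ?g = 0" "stress_e ?f ?g = 0"
    unfolding stress_x_def stress_e_def using assms(1)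
    by (intro sum3_zero; simp only: flex_at_inc flex_at_edge incidences adjacencies dvertsI dnormalsI signs_simps; simp)+
  then show ?thesis
    using assms(2) unfolding stress_linear stress_x_equilibrium stress_e_equilibrium stress_forms_vanish_def Let_def by simp
qed

text \<open>Coordinates on the 5-dimensional space of gauged infinitesimal flexes: \<open>coef_e\<close> and \<open>coef_x\<close> of
  \<open>w\<close> and of its two rotated copies, the three values of \<open>coef_e\<close> having sum \<open>0\<close>.\<close>

definition coef_e :: "(real^3 \<Rightarrow> real^3) \<Rightarrow> real" where
  "coef_e w = sum3 (\<lambda>r s t. r * w (vA r s t) $ 1) / 8"
definition coef_x :: "(real^3 \<Rightarrow> real^3) \<Rightarrow> real" where
  "coef_x w = sum3 (\<lambda>r s t. r * s * t * w (vA r s t) $ 1) / 8"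

text \<open>Fourier inversion on the group of sign changes, whose eight characters are the
  squarefree monomials in \<open>r\<close>, \<open>s\<close>, \<open>t\<close>.\<close>

lemma sum3_inversion:
  assumes "r \<in> signs" "s \<in> signs" "t \<in> signs"
  shows "8 * f r s t = sum3 f + r * sum3 (\<lambda>r s t. r * f r s t) + s * sum3 (\<lambda>r s t. s * f r s t)
    + t * sum3 (\<lambda>r s t. t * f r s t) + s * t * sum3 (\<lambda>r s t. s * t * f r s t)
    + r * t * sum3 (\<lambda>r s t. r * t * f r s t) + r * s * sum3 (\<lambda>r s t. r * s * f r s t)
    + r * s * t * sum3 (\<lambda>r s t. r * s * t * f r s t)"
  using assms by (auto simp: signs_def sum3_expand)

context
  fixes w b :: "real^3 \<Rightarrow> real^3"
  assumes flex: "flex_at 0 w b" and gauged: "gauged w"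
begin

lemma first_order:
  assumes "r \<in> signs" "s \<in> signs" "t \<in> signs"
  shows "w (vA r s t) \<bullet> nX s t + vA r s t \<bullet> b (nX s t) = 0"
    "w (vB s t) \<bullet> nX s t + vB s t \<bullet> b (nX s t) = 0"
    "w (vC t r) \<bullet> nX s t + vC t r \<bullet> b (nX s t) = 0"
    "w (vA r s t) \<bullet> nY t r + vA r s t \<bullet> b (nY t r) = 0"
    "w (vC t r) \<bullet> nY t r + vC t r \<bullet> b (nY t r) = 0"
    "w (vD r s) \<bullet> nY t r + vD r s \<bullet> b (nY t r) = 0"
    "w (vA r s t) \<bullet> nZ r s + vA r s t \<bullet> b (nZ r s) = 0"
    "w (vD r s) \<bullet> nZ r s + vD r s \<bullet> b (nZ r s) = 0"
    "w (vB s t) \<bullet> nZ r s + vB s t \<bullet> b (nZ r s) = 0"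
    "(vA r s t - vB s t) \<bullet> (w (vA r s t) - w (vB s t)) = 0"
    "(vA r s t - vC t r) \<bullet> (w (vA r s t) - w (vC t r)) = 0"
    "(vA r s t - vD r s) \<bullet> (w (vA r s t) - w (vD r s)) = 0"
    "(vB s t - vB s (-t)) \<bullet> (w (vB s t) - w (vB s (-t))) = 0"
    "(vC t r - vC t (-r)) \<bullet> (w (vC t r) - w (vC t (-r))) = 0"
    "(vD r s - vD r (-s)) \<bullet> (w (vD r s) - w (vD r (-s))) = 0"
  using flex_at_inc[OF flex] flex_at_edge[OF flex] assms
  by (simp_all add: incidences adjacencies del: inner_eq_zero_iff)

text \<open>Taking for \<open>m\<close> the characters \<open>1\<close>, \<open>s * t\<close>,
  \<open>r\<close> and \<open>r * s * t\<close> projects the linearized constraints to the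
  hypotheses of the four block lemmas.\<close>

lemma first_order_sums:
  fixes m :: "real \<Rightarrow> real \<Rightarrow> real \<Rightarrow> real"
  shows "sum3 (\<lambda>r s t. m r s t * (w (vA r s t) \<bullet> nX s t + vA r s t \<bullet> b (nX s t))) = 0"
    "sum3 (\<lambda>r s t. m r s t * (w (vB s t) \<bullet> nX s t + vB s t \<bullet> b (nX s t))) = 0"
    "sum3 (\<lambda>r s t. m r s t * (w (vC t r) \<bullet> nX s t + vC t r \<bullet> b (nX s t))) = 0"
    "sum3 (\<lambda>r s t. m r s t * (w (vA r s t) \<bullet> nY t r + vA r s t \<bullet> b (nY t r))) = 0"
    "sum3 (\<lambda>r s t. m r s t * (w (vC t r) \<bullet> nY t r + vC t r \<bullet> b (nY t r))) = 0"
    "sum3 (\<lambda>r s t. m r s t * (w (vD r s) \<bullet> nY t r + vD r s \<bullet> b (nY t r))) = 0"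
    "sum3 (\<lambda>r s t. m r s t * (w (vA r s t) \<bullet> nZ r s + vA r s t \<bullet> b (nZ r s))) = 0"
    "sum3 (\<lambda>r s t. m r s t * (w (vD r s) \<bullet> nZ r s + vD r s \<bullet> b (nZ r s))) = 0"
    "sum3 (\<lambda>r s t. m r s t * (w (vB s t) \<bullet> nZ r s + vB s t \<bullet> b (nZ r s))) = 0"
    "sum3 (\<lambda>r s t. m r s t * ((vA r s t - vB s t) \<bullet> (w (vA r s t) - w (vB s t)))) = 0"
    "sum3 (\<lambda>r s t. m r s t * ((vA r s t - vC t r) \<bullet> (w (vA r s t) - w (vC t r)))) = 0"
    "sum3 (\<lambda>r s t. m r s t * ((vA r s t - vD r s) \<bullet> (w (vA r s t) - w (vD r s)))) = 0"
    "sum3 (\<lambda>r s t. m r s t * ((vB s t - vB s (-t)) \<bullet> (w (vB s t) - w (vB s (-t))))) = 0"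
    "sum3 (\<lambda>r s t. m r s t * ((vC t r - vC t (-r)) \<bullet> (w (vC t r) - w (vC t (-r))))) = 0"
    "sum3 (\<lambda>r s t. m r s t * ((vD r s - vD r (-s)) \<bullet> (w (vD r s) - w (vD r (-s))))) = 0"
  by (intro sum3_zero; simp only: first_order mult_zero_right)+

lemma block_invariant_sums:
  shows "sum3 (\<lambda>r s t. r * w (vA r s t) $ 1) + sum3 (\<lambda>r s t. s * w (vA r s t) $ 2)
      + sum3 (\<lambda>r s t. t * w (vA r s t) $ 3) = 0"
    and "sum3 (\<lambda>r s t. s * w (vB s t) $ 2) = phi * sum3 (\<lambda>r s t. s * w (vA r s t) $ 2)
        - sum3 (\<lambda>r s t. r * w (vA r s t) $ 1)"
    and "sum3 (\<lambda>r s t. t * w (vC t r) $ 3) = phi * sum3 (\<lambda>r s t. t * w (vA r s t) $ 3)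
        - sum3 (\<lambda>r s t. s * w (vA r s t) $ 2)"
    and "sum3 (\<lambda>r s t. r * w (vD r s) $ 1) = phi * sum3 (\<lambda>r s t. r * w (vA r s t) $ 1)
        - sum3 (\<lambda>r s t. t * w (vA r s t) $ 3)"
    and "sum3 (\<lambda>r s t. s * b (nX s t) $ 2) = 2 * (phi-2) * sum3 (\<lambda>r s t. s * w (vA r s t) $ 2)"
    and "sum3 (\<lambda>r s t. t * b (nX s t) $ 3) =
        (1-phi) * sum3 (\<lambda>r s t. t * w (vA r s t) $ 3)+(2-phi) * sum3 (\<lambda>r s t. s * w (vA r s t) $ 2)"
    and "sum3 (\<lambda>r s t. t * b (nY t r) $ 3) = 2 * (phi-2) * sum3 (\<lambda>r s t. t * w (vA r s t) $ 3)"
    and "sum3 (\<lambda>r s t. r * b (nY t r) $ 1) =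
        (1-phi) * sum3 (\<lambda>r s t. r * w (vA r s t) $ 1)+(2-phi) * sum3 (\<lambda>r s t. t * w (vA r s t) $ 3)"
    and "sum3 (\<lambda>r s t. r * b (nZ r s) $ 1) = 2 * (phi-2) * sum3 (\<lambda>r s t. r * w (vA r s t) $ 1)"
    and "sum3 (\<lambda>r s t. s * b (nZ r s) $ 2) =
        (1-phi) * sum3 (\<lambda>r s t. s * w (vA r s t) $ 2)+(2-phi) * sum3 (\<lambda>r s t. r * w (vA r s t) $ 1)"
    and "sum3 (\<lambda>r s t. r * w (vC t r) $ 1) = 0"
proof -
  let ?A2 = "sum3 (\<lambda>r s t. s * w (vA r s t) $ 2)"
  let ?X2 = "sum3 (\<lambda>r s t. s * b (nX s t) $ 2)"
  let ?A3 = "sum3 (\<lambda>r s t. t * w (vA r s t) $ 3)"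
  let ?X3 = "sum3 (\<lambda>r s t. t * b (nX s t) $ 3)"
  let ?B2 = "sum3 (\<lambda>r s t. s * w (vB s t) $ 2)"
  let ?B3 = "sum3 (\<lambda>r s t. t * w (vB s t) $ 3)"
  let ?C3 = "sum3 (\<lambda>r s t. t * w (vC t r) $ 3)"
  let ?Y3 = "sum3 (\<lambda>r s t. t * b (nY t r) $ 3)"
  let ?A1 = "sum3 (\<lambda>r s t. r * w (vA r s t) $ 1)"
  let ?Y1 = "sum3 (\<lambda>r s t. r * b (nY t r) $ 1)"
  let ?D1 = "sum3 (\<lambda>r s t. r * w (vD r s) $ 1)"
  let ?Z1 = "sum3 (\<lambda>r s t. r * b (nZ r s) $ 1)"
  let ?Z2 = "sum3 (\<lambda>r s t. s * b (nZ r s) $ 2)"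
  let ?C1 = "sum3 (\<lambda>r s t. r * w (vC t r) $ 1)"
  let ?D2 = "sum3 (\<lambda>r s t. s * w (vD r s) $ 2)"
  have XA: "(2-phi) * ?A2 + ?X2 + (phi-1) * ?A3 + ?X3 = 0"
    by (rule trans[OF _ first_order_sums(1)[of "\<lambda>r s t. 1"]])
      (simp add: sum3_expand inner_3 point_defs algebra_simps)
  have XB: "(2-phi) * ?B2 + phi * ?X2 + (phi-1) * ?B3 + (phi-1) * ?X3 = 0"
    by (rule trans[OF _ first_order_sums(2)[of "\<lambda>r s t. 1"]])
      (simp add: sum3_expand inner_3 point_defs algebra_simps)
  have XC: "(phi-1) * ?C3 + phi * ?X3 = 0"
    by (rule trans[OF _ first_order_sums(3)[of "\<lambda>r s t. 1"]])
      (simp add: sum3_expand inner_3 point_defs algebra_simps)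
  have YA: "(2-phi) * ?A3 + ?Y3 + (phi-1) * ?A1 + ?Y1 = 0"
    by (rule trans[OF _ first_order_sums(4)[of "\<lambda>r s t. 1"]])
      (simp add: sum3_expand inner_3 point_defs algebra_simps)
  have YD: "(phi-1) * ?D1 + phi * ?Y1 = 0"
    by (rule trans[OF _ first_order_sums(6)[of "\<lambda>r s t. 1"]])
      (simp add: sum3_expand inner_3 point_defs algebra_simps)
  have ZA: "(2-phi) * ?A1 + ?Z1 + (phi-1) * ?A2 + ?Z2 = 0"
    by (rule trans[OF _ first_order_sums(7)[of "\<lambda>r s t. 1"]])
      (simp add: sum3_expand inner_3 point_defs algebra_simps)
  have ZB: "(phi-1) * ?B2 + phi * ?Z2 = 0"
    by (rule trans[OF _ first_order_sums(9)[of "\<lambda>r s t. 1"]])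
      (simp add: sum3_expand inner_3 point_defs algebra_simps)
  have AB: "?A1 + (1-phi) * (?A2-?B2) + (2-phi) * (?A3-?B3) = 0"
    by (rule trans[OF _ first_order_sums(10)[of "\<lambda>r s t. 1"]])
      (simp add: sum3_expand inner_3 point_defs algebra_simps)
  have AC: "?A2 + (1-phi) * (?A3-?C3) + (2-phi) * (?A1-?C1) = 0"
    by (rule trans[OF _ first_order_sums(11)[of "\<lambda>r s t. 1"]])
      (simp add: sum3_expand inner_3 point_defs algebra_simps)
  have AD: "?A3 + (1-phi) * (?A1-?D1) + (2-phi) * (?A2-?D2) = 0"
    by (rule trans[OF _ first_order_sums(12)[of "\<lambda>r s t. 1"]])
      (simp add: sum3_expand inner_3 point_defs algebra_simps)
  \<comment> \<open>The edge from \<open>vB s t\<close> to \<open>vB s (-t)\<close> is parallel to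
    the third axis and has length \<open>2 * (phi - 1)\<close>, so its equation involves only third
    coordinates.\<close>
  have "4 * (phi - 1) * ?B3 = 0"
    by (rule trans[OF _ first_order_sums(13)[of "\<lambda>r s t. 1"]])
      (simp add: sum3_expand inner_3 point_defs algebra_simps)
  then have B3: "?B3 = 0"
    using phi_bounds by simp
  have "4 * (phi - 1) * ?C1 = 0"
    by (rule trans[OF _ first_order_sums(14)[of "\<lambda>r s t. 1"]])
      (simp add: sum3_expand inner_3 point_defs algebra_simps)
  then have C1: "?C1 = 0"
    using phi_bounds by simp
  have "4 * (phi - 1) * ?D2 = 0"
    by (rule trans[OF _ first_order_sums(15)[of "\<lambda>r s t. 1"]])
      (simp add: sum3_expand inner_3 point_defs algebra_simps)
  then have D2: "?D2 = 0"
    using phi_bounds by simp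
  note block = block_invariant[OF phi_sq XA XB XC YA YD ZA ZB AB AC AD B3 C1 D2]
  show "?A1 + ?A2 + ?A3 = 0" "?B2 = phi * ?A2 - ?A1" "?C3 = phi * ?A3 - ?A2" "?D1 = phi * ?A1
      - ?A3" "?X2 = 2 * (phi-2) * ?A2" "?X3 = (1-phi) * ?A3+(2-phi) * ?A2" "?Y3 =
      2 * (phi-2) * ?A3" "?Y1 = (1-phi) * ?A1+(2-phi) * ?A3" "?Z1 = 2 * (phi-2) * ?A1" "?Z2 =
      (1-phi) * ?A2+(2-phi) * ?A1" "?C1 = 0"
    by (fact block B3 C1 D2)+
qed

lemma block_rotational_sums:
  shows "sum3 (\<lambda>r s t. t * w (vA r s t) $ 2) = (phi+1) * sum3 (\<lambda>r s t. r * s * t * w (vA r s t) $ 1)"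
    and "sum3 (\<lambda>r s t. s * w (vA r s t) $ 3) = phi * sum3 (\<lambda>r s t. r * s * t * w (vA r s t) $ 1)"
    and "sum3 (\<lambda>r s t. t * w (vB s t) $ 2) = 2 * sum3 (\<lambda>r s t. r * s * t * w (vA r s t) $ 1)"
    and "sum3 (\<lambda>r s t. s * w (vB s t) $ 3) = 2 * phi * sum3 (\<lambda>r s t. r * s * t * w (vA r s t) $ 1)"
    and "sum3 (\<lambda>r s t. t * w (vC t r) $ 2) = 2 * sum3 (\<lambda>r s t. r * s * t * w (vA r s t) $ 1)"
    and "sum3 (\<lambda>r s t. s * w (vD r s) $ 3) = 2 * sum3 (\<lambda>r s t. r * s * t * w (vA r s t) $ 1)"
    and "sum3 (\<lambda>r s t. t * b (nX s t) $ 2) = 4 * (phi-2) * sum3 (\<lambda>r s t. r * s * t * w (vA r s t) $ 1)"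
    and "sum3 (\<lambda>r s t. s * b (nX s t) $ 3) = 2 * (3-2 * phi) * sum3 (\<lambda>r s t. r * s * t * w (vA r s t) $ 1)"
    and "sum3 (\<lambda>r s t. t * b (nY t r) $ 2) = 2 * (1-phi) * sum3 (\<lambda>r s t. r * s * t * w (vA r s t) $ 1)"
    and "sum3 (\<lambda>r s t. s * b (nZ r s) $ 3) = -2 * sum3 (\<lambda>r s t. r * s * t * w (vA r s t) $ 1)"
proof -
  let ?A2 = "sum3 (\<lambda>r s t. t * w (vA r s t) $ 2)"
  let ?X2 = "sum3 (\<lambda>r s t. t * b (nX s t) $ 2)"
  let ?A3 = "sum3 (\<lambda>r s t. s * w (vA r s t) $ 3)"
  let ?X3 = "sum3 (\<lambda>r s t. s * b (nX s t) $ 3)"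
  let ?C2 = "sum3 (\<lambda>r s t. t * w (vC t r) $ 2)"
  let ?A1 = "sum3 (\<lambda>r s t. r * s * t * w (vA r s t) $ 1)"
  let ?Y2 = "sum3 (\<lambda>r s t. t * b (nY t r) $ 2)"
  let ?D3 = "sum3 (\<lambda>r s t. s * w (vD r s) $ 3)"
  let ?Z3 = "sum3 (\<lambda>r s t. s * b (nZ r s) $ 3)"
  let ?B2 = "sum3 (\<lambda>r s t. t * w (vB s t) $ 2)"
  let ?B3 = "sum3 (\<lambda>r s t. s * w (vB s t) $ 3)"
  have XA: "(2-phi) * ?A2 + ?X2 + (phi-1) * ?A3 + ?X3 = 0"
    by (rule trans[OF _ first_order_sums(1)[of "\<lambda>r s t. s * t"]])
      (simp add: sum3_expand inner_3 point_defs algebra_simps)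
  have XC: "(2-phi) * ?C2 + phi * ?X3 = 0"
    by (rule trans[OF _ first_order_sums(3)[of "\<lambda>r s t. s * t"]])
      (simp add: sum3_expand inner_3 point_defs algebra_simps)
  have YA: "(phi-1) * ?A1 + ?Y2 + (2-phi) * ?A3 = 0"
    by (rule trans[OF _ first_order_sums(4)[of "\<lambda>r s t. s * t"]])
      (simp add: sum3_expand inner_3 point_defs algebra_simps)
  have YD: "(phi-1) * ?Y2 + (2-phi) * ?D3 = 0"
    by (rule trans[OF _ first_order_sums(6)[of "\<lambda>r s t. s * t"]])
      (simp add: sum3_expand inner_3 point_defs algebra_simps)
  have ZA: "(2-phi) * ?A1 + (phi-1) * ?A2 + ?Z3 = 0"
    by (rule trans[OF _ first_order_sums(7)[of "\<lambda>r s t. s * t"]])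
      (simp add: sum3_expand inner_3 point_defs algebra_simps)
  have ZB: "(phi-1) * ?B2 + (phi-1) * ?Z3 = 0"
    by (rule trans[OF _ first_order_sums(9)[of "\<lambda>r s t. s * t"]])
      (simp add: sum3_expand inner_3 point_defs algebra_simps)
  have AB: "?A1 + (1-phi) * (?A2-?B2) + (2-phi) * (?A3-?B3) = 0"
    by (rule trans[OF _ first_order_sums(10)[of "\<lambda>r s t. s * t"]])
      (simp add: sum3_expand inner_3 point_defs algebra_simps)
  have AC: "(2-phi) * ?A1 + ?A2 - ?C2 + (1-phi) * ?A3 = 0"
    by (rule trans[OF _ first_order_sums(11)[of "\<lambda>r s t. s * t"]])
      (simp add: sum3_expand inner_3 point_defs algebra_simps)
  have AD: "(1-phi) * ?A1 + (2-phi) * ?A2 + ?A3 - ?D3 = 0"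
    by (rule trans[OF _ first_order_sums(12)[of "\<lambda>r s t. s * t"]])
      (simp add: sum3_expand inner_3 point_defs algebra_simps)
  \<comment> \<open>The first component of the moment condition in \<open>gauged\<close>.\<close>
  have gauge: "2 * (?A2 - ?A3) + (phi-1) * ?B2 - phi * ?B3 + phi * ?C2 - (phi-1) * ?D3 = 0"
    using gauged unfolding gauged_def sum_dverts sum3_expand sum_signs
    by (simp add: vec_eq_iff forall_3 cross3_simps point_defs algebra_simps)
  note block = block_rotational[OF phi_sq XA XC YA YD ZA ZB AB AC AD gauge]
  show "?A2 = (phi+1) * ?A1" "?A3 = phi * ?A1" "?B2 = 2 * ?A1" "?B3 = 2 * phi * ?A1" "?C2 =
      2 * ?A1" "?D3 = 2 * ?A1" "?X2 = 4 * (phi-2) * ?A1" "?X3 = 2 * (3-2 * phi) * ?A1" "?Y2 =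
      2 * (1-phi) * ?A1" "?Z3 = -2 * ?A1"
    by (fact block)+
qed

lemma block_translational_sums:
  shows "sum3 (\<lambda>r s t. w (vA r s t) $ 1) = 0"
    and "sum3 (\<lambda>r s t. r * s * w (vA r s t) $ 2) = 0"
    and "sum3 (\<lambda>r s t. r * t * w (vA r s t) $ 3) = 0"
    and "sum3 (\<lambda>r s t. w (vB s t) $ 1) = 0"
    and "sum3 (\<lambda>r s t. w (vC t r) $ 1) = 0"
    and "sum3 (\<lambda>r s t. r * t * w (vC t r) $ 3) = 0"
    and "sum3 (\<lambda>r s t. w (vD r s) $ 1) = 0"
    and "sum3 (\<lambda>r s t. b (nX s t) $ 1) = 0"
    and "sum3 (\<lambda>r s t. b (nY t r) $ 1) = 0"
    and "sum3 (\<lambda>r s t. r * t * b (nY t r) $ 3) = 0"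
    and "sum3 (\<lambda>r s t. b (nZ r s) $ 1) = 0"
    and "sum3 (\<lambda>r s t. r * s * b (nZ r s) $ 2) = 0"
    and "sum3 (\<lambda>r s t. r * s * w (vD r s) $ 2) = 0"
proof -
  let ?X1 = "sum3 (\<lambda>r s t. b (nX s t) $ 1)"
  let ?A2 = "sum3 (\<lambda>r s t. r * s * w (vA r s t) $ 2)"
  let ?A3 = "sum3 (\<lambda>r s t. r * t * w (vA r s t) $ 3)"
  let ?C3 = "sum3 (\<lambda>r s t. r * t * w (vC t r) $ 3)"
  let ?A1 = "sum3 (\<lambda>r s t. w (vA r s t) $ 1)"
  let ?Y1 = "sum3 (\<lambda>r s t. b (nY t r) $ 1)"
  let ?Y3 = "sum3 (\<lambda>r s t. r * t * b (nY t r) $ 3)"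
  let ?C1 = "sum3 (\<lambda>r s t. w (vC t r) $ 1)"
  let ?D1 = "sum3 (\<lambda>r s t. w (vD r s) $ 1)"
  let ?Z1 = "sum3 (\<lambda>r s t. b (nZ r s) $ 1)"
  let ?Z2 = "sum3 (\<lambda>r s t. r * s * b (nZ r s) $ 2)"
  let ?D2 = "sum3 (\<lambda>r s t. r * s * w (vD r s) $ 2)"
  let ?B1 = "sum3 (\<lambda>r s t. w (vB s t) $ 1)"
  have XA: "?X1 + (2-phi) * ?A2 + (phi-1) * ?A3 = 0"
    by (rule trans[OF _ first_order_sums(1)[of "\<lambda>r s t. r"]])
      (simp add: sum3_expand inner_3 point_defs algebra_simps)
  have XC: "(phi-1) * ?X1 + (phi-1) * ?C3 = 0"
    by (rule trans[OF _ first_order_sums(3)[of "\<lambda>r s t. r"]])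
      (simp add: sum3_expand inner_3 point_defs algebra_simps)
  have YA: "(phi-1) * ?A1 + ?Y1 + (2-phi) * ?A3+?Y3 = 0"
    by (rule trans[OF _ first_order_sums(4)[of "\<lambda>r s t. r"]])
      (simp add: sum3_expand inner_3 point_defs algebra_simps)
  have YC: "(phi-1) * ?C1 + (phi-1) * ?Y1 + (2-phi) * ?C3 + phi * ?Y3 = 0"
    by (rule trans[OF _ first_order_sums(5)[of "\<lambda>r s t. r"]])
      (simp add: sum3_expand inner_3 point_defs algebra_simps)
  have YD: "(phi-1) * ?D1 + phi  *  ?Y1 = 0"
    by (rule trans[OF _ first_order_sums(6)[of "\<lambda>r s t. r"]])
      (simp add: sum3_expand inner_3 point_defs algebra_simps)
  have ZA: "(2-phi) * ?A1 + ?Z1 + (phi-1) * ?A2 + ?Z2 = 0"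
    by (rule trans[OF _ first_order_sums(7)[of "\<lambda>r s t. r"]])
      (simp add: sum3_expand inner_3 point_defs algebra_simps)
  have ZD: "(2-phi) * ?D1 + phi * ?Z1 + (phi-1) * ?D2 + (phi-1) * ?Z2 = 0"
    by (rule trans[OF _ first_order_sums(8)[of "\<lambda>r s t. r"]])
      (simp add: sum3_expand inner_3 point_defs algebra_simps)
  have ZB: "(2-phi) * ?B1 + phi * ?Z2 = 0"
    by (rule trans[OF _ first_order_sums(9)[of "\<lambda>r s t. r"]])
      (simp add: sum3_expand inner_3 point_defs algebra_simps)
  have AB: "?A1 - ?B1 + (1-phi) * ?A2 + (2-phi) * ?A3 = 0"
    by (rule trans[OF _ first_order_sums(10)[of "\<lambda>r s t. r"]])
      (simp add: sum3_expand inner_3 point_defs algebra_simps)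
  have AC: "(2-phi) * (?A1-?C1) + ?A2 + (1-phi) * (?A3-?C3) = 0"
    by (rule trans[OF _ first_order_sums(11)[of "\<lambda>r s t. r"]])
      (simp add: sum3_expand inner_3 point_defs algebra_simps)
  have AD: "(1-phi) * (?A1-?D1) + (2-phi) * (?A2-?D2) + ?A3 = 0"
    by (rule trans[OF _ first_order_sums(12)[of "\<lambda>r s t. r"]])
      (simp add: sum3_expand inner_3 point_defs algebra_simps)
  have gauge: "2 * ?A1+?B1+?C1+?D1 = 0"
    using gauged unfolding gauged_def sum_dverts sum3_expand sum_signs
    by (simp add: vec_eq_iff forall_3 cross3_simps point_defs algebra_simps)
  have "4 * (phi - 1) * ?D2 = 0"
    by (rule trans[OF _ first_order_sums(15)[of "\<lambda>r s t. r"]])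
      (simp add: sum3_expand inner_3 point_defs algebra_simps)
  then have D2: "?D2 = 0"
    using phi_bounds by simp
  note block = block_translational[OF phi_sq XA XC YA YC YD ZA ZD ZB AB AC AD D2 gauge]
  show "?A1 = 0" "?A2 = 0" "?A3 = 0" "?B1 = 0" "?C1 = 0" "?C3 = 0" "?D1 = 0" "?X1 = 0" "?Y1 = 0" "?Y3 =
      0" "?Z1 = 0" "?Z2 = 0" "?D2 = 0"
    by (fact block D2)+
qed

lemma block_odd_sums:
  shows "sum3 (\<lambda>r s t. s * t * w (vA r s t) $ 1) = 0"
    and "sum3 (\<lambda>r s t. r * t * w (vA r s t) $ 2) = 0"
    and "sum3 (\<lambda>r s t. r * s * w (vA r s t) $ 3) = 0"
    and "sum3 (\<lambda>r s t. s * t * w (vB s t) $ 1) = 0"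
    and "sum3 (\<lambda>r s t. r * t * w (vC t r) $ 2) = 0"
    and "sum3 (\<lambda>r s t. r * s * w (vD r s) $ 3) = 0"
    and "sum3 (\<lambda>r s t. s * t * b (nX s t) $ 1) = 0"
    and "sum3 (\<lambda>r s t. r * t * b (nY t r) $ 2) = 0"
    and "sum3 (\<lambda>r s t. r * s * b (nZ r s) $ 3) = 0"
proof -
  let ?X1 = "sum3 (\<lambda>r s t. s * t * b (nX s t) $ 1)"
  let ?A2 = "sum3 (\<lambda>r s t. r * t * w (vA r s t) $ 2)"
  let ?A3 = "sum3 (\<lambda>r s t. r * s * w (vA r s t) $ 3)"
  let ?C2 = "sum3 (\<lambda>r s t. r * t * w (vC t r) $ 2)"
  let ?Y2 = "sum3 (\<lambda>r s t. r * t * b (nY t r) $ 2)"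
  let ?A1 = "sum3 (\<lambda>r s t. s * t * w (vA r s t) $ 1)"
  let ?D3 = "sum3 (\<lambda>r s t. r * s * w (vD r s) $ 3)"
  let ?Z3 = "sum3 (\<lambda>r s t. r * s * b (nZ r s) $ 3)"
  let ?B1 = "sum3 (\<lambda>r s t. s * t * w (vB s t) $ 1)"
  have XA: "?X1 + (2-phi) * ?A2 + (phi-1) * ?A3 = 0"
    by (rule trans[OF _ first_order_sums(1)[of "\<lambda>r s t. r * s * t"]])
      (simp add: sum3_expand inner_3 point_defs algebra_simps)
  have XC: "(phi-1) * ?X1 + (2-phi) * ?C2 = 0"
    by (rule trans[OF _ first_order_sums(3)[of "\<lambda>r s t. r * s * t"]])
      (simp add: sum3_expand inner_3 point_defs algebra_simps)
  have YA: "?Y2 + (2-phi) * ?A3 + (phi-1) * ?A1 = 0"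
    by (rule trans[OF _ first_order_sums(4)[of "\<lambda>r s t. r * s * t"]])
      (simp add: sum3_expand inner_3 point_defs algebra_simps)
  have YD: "(phi-1) * ?Y2 + (2-phi) * ?D3 = 0"
    by (rule trans[OF _ first_order_sums(6)[of "\<lambda>r s t. r * s * t"]])
      (simp add: sum3_expand inner_3 point_defs algebra_simps)
  have ZA: "?Z3 + (2-phi) * ?A1 + (phi-1) * ?A2 = 0"
    by (rule trans[OF _ first_order_sums(7)[of "\<lambda>r s t. r * s * t"]])
      (simp add: sum3_expand inner_3 point_defs algebra_simps)
  have ZB: "(phi-1) * ?Z3 + (2-phi) * ?B1 = 0"
    by (rule trans[OF _ first_order_sums(9)[of "\<lambda>r s t. r * s * t"]])
      (simp add: sum3_expand inner_3 point_defs algebra_simps)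
  have AB: "?A1 - ?B1 + (1-phi) * ?A2 + (2-phi) * ?A3 = 0"
    by (rule trans[OF _ first_order_sums(10)[of "\<lambda>r s t. r * s * t"]])
      (simp add: sum3_expand inner_3 point_defs algebra_simps)
  have AC: "?A2 - ?C2 + (1-phi) * ?A3 + (2-phi) * ?A1 = 0"
    by (rule trans[OF _ first_order_sums(11)[of "\<lambda>r s t. r * s * t"]])
      (simp add: sum3_expand inner_3 point_defs algebra_simps)
  have AD: "?A3 - ?D3 + (1-phi) * ?A1 + (2-phi) * ?A2 = 0"
    by (rule trans[OF _ first_order_sums(12)[of "\<lambda>r s t. r * s * t"]])
      (simp add: sum3_expand inner_3 point_defs algebra_simps)
  note block = block_odd[OF phi_sq XA XC YA YD ZA ZB AB AC AD]
  show "?A1 = 0" "?A2 = 0" "?A3 = 0" "?B1 = 0" "?C2 = 0" "?D3 = 0" "?X1 = 0" "?Y2 = 0" "?Z3 = 0"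
    by (fact block)+
qed

end

section \<open>Infinitesimal flexes\<close>

text \<open>Each Fourier coefficient of a first coordinate is supplied by a block of
  \<open>w\<close> or of a rotated copy, according to its character; \<open>sum3_inversion\<close>
  then reassembles the values.\<close>

lemma first_components:
  assumes flex: "flex_at 0 w b" and gauged: "gauged w"
    and rst: "r \<in> signs" "s \<in> signs" "t \<in> signs"
    and e1: "e1 = coef_e w" and e3: "e3 = coef_e (conj_cyc (conj_cyc w))"
    and x: "x = coef_x w" and y: "y = coef_x (conj_cyc w)" and z: "z = coef_x (conj_cyc (conj_cyc w))"
  shows "w (vA r s t) $ 1 = r * e1 + r * s * t * x + phi * (t * y) + (phi + 1) * (s * z)"
    "w (vB s t) $ 1 = 2 * (t * y + s * z)"
    "w (vC t r) $ 1 = 2 * phi * (t * y)"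
    "w (vD r s) $ 1 = r * (phi * e1 - e3) + 2 * (s * z)"
    "b (nX s t) $ 1 = - 2 * (t * y) + 2 * (1 - phi) * (s * z)"
    "b (nY t r) $ 1 = r * ((1 - phi) * e1 + (2 - phi) * e3) + 2 * (3 - 2 * phi) * (t * y)"
    "b (nZ r s) $ 1 = 2 * (phi - 2) * (r * e1) + 4 * (phi - 2) * (s * z)"
proof -
  note flex1 = flex_at_cyc[OF flex] and gauged1 = gauged_cyc[OF gauged]
  note flex2 = flex_at_cyc[OF flex1] and gauged2 = gauged_cyc[OF gauged1]
  let ?e1 = "sum3 (\<lambda>r s t. r * w (vA r s t) $ 1)" and ?e3 = "sum3 (\<lambda>r s t. t * w (vA r s t) $ 3)"
    and ?x = "sum3 (\<lambda>r s t. r * s * t * w (vA r s t) $ 1)"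
    and ?y = "sum3 (\<lambda>r s t. r * s * t * w (vA r s t) $ 2)"
    and ?z = "sum3 (\<lambda>r s t. r * s * t * w (vA r s t) $ 3)"
  have coefs: "?e1 = 8 * e1" "?e3 = 8 * e3" "?x = 8 * x" "?y = 8 * y" "?z = 8 * z"
    by (simp_all add: e1 e3 x y z coef_e_def coef_x_def conj_cyc_def sum3_expand)
  note defs = conj_cyc_def sum3_expand
  note diag = block_invariant_sums[OF flex gauged]
    and a = block_odd_sums[OF flex gauged]
    and bx1 = block_rotational_sums[OF flex1 gauged1] and bx2 = block_rotational_sums[OF flex2 gauged2]
    and ux0 = block_translational_sums[OF flex gauged] and ux1 = block_translational_sums[OF flex1 gauged1]
    and ux2 = block_translational_sums[OF flex2 gauged2]
  have A1_1: "sum3 (\<lambda>r s t. w (vA r s t) $ 1) = 0"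
    using ux0(1) by (simp add: defs algebra_simps)
  have A1_s: "sum3 (\<lambda>r s t. s * w (vA r s t) $ 1) = (phi+1) * ?z"
    using bx2(1) by (simp add: defs algebra_simps)
  have A1_t: "sum3 (\<lambda>r s t. t * w (vA r s t) $ 1) = phi * ?y"
    using bx1(2) by (simp add: defs algebra_simps)
  have A1_st: "sum3 (\<lambda>r s t. s * t * w (vA r s t) $ 1) = 0"
    using a(1) by (simp add: defs algebra_simps)
  have A1_rt: "sum3 (\<lambda>r s t. r * t * w (vA r s t) $ 1) = 0"
    using ux2(2) by (simp add: defs algebra_simps)
  have A1_rs: "sum3 (\<lambda>r s t. r * s * w (vA r s t) $ 1) = 0"
    using ux1(3) by (simp add: defs algebra_simps)
  show "w (vA r s t) $ 1 = r * e1 + r * s * t * x + phi * (t * y) + (phi + 1) * (s * z)"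
    using sum3_inversion[OF rst, of "\<lambda>r s t. w (vA r s t) $ 1"]
    unfolding A1_1 A1_s A1_t A1_st A1_rt A1_rs coefs by (simp add: algebra_simps)
  have B1_1: "sum3 (\<lambda>r s t. w (vB s t) $ 1) = 0"
    using ux0(4) by (simp add: defs algebra_simps)
  have B1_s: "sum3 (\<lambda>r s t. s * w (vB s t) $ 1) = 2 * ?z"
    using bx2(5) by (simp add: defs algebra_simps)
  have B1_t: "sum3 (\<lambda>r s t. t * w (vB s t) $ 1) = 2 * ?y"
    using bx1(6) by (simp add: defs algebra_simps)
  have B1_st: "sum3 (\<lambda>r s t. s * t * w (vB s t) $ 1) = 0"
    using a(4) by (simp add: defs algebra_simps)
  \<comment> \<open>A value independent of \<open>r\<close> has no component in the characters that
    involve \<open>r\<close>. The same holds below for the sign missing in each family.\<close>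
  have B1_0: "sum3 (\<lambda>r s t. r * w (vB s t) $ 1) = 0" "sum3 (\<lambda>r s t. r * t * w (vB s t) $ 1) =
      0" "sum3 (\<lambda>r s t. r * s * w (vB s t) $ 1) = 0" "sum3 (\<lambda>r s t. r * s * t * w (vB s t) $ 1) = 0"
    by (simp_all add: sum3_expand)
  show "w (vB s t) $ 1 = 2 * (t * y + s * z)"
    using sum3_inversion[OF rst, of "\<lambda>r s t. w (vB s t) $ 1"]
    unfolding B1_1 B1_s B1_t B1_st B1_0 coefs by (simp add: algebra_simps)
  have C1_1: "sum3 (\<lambda>r s t. w (vC t r) $ 1) = 0"
    using ux0(5) by (simp add: defs algebra_simps)
  have C1_r: "sum3 (\<lambda>r s t. r * w (vC t r) $ 1) = 0"
    using diag(11) by (simp add: defs algebra_simps)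
  have C1_t: "sum3 (\<lambda>r s t. t * w (vC t r) $ 1) = 2 * phi * ?y"
    using bx1(4) by (simp add: defs algebra_simps)
  have C1_rt: "sum3 (\<lambda>r s t. r * t * w (vC t r) $ 1) = 0"
    using ux2(13) by (simp add: defs algebra_simps)
  have C1_0: "sum3 (\<lambda>r s t. s * w (vC t r) $ 1) = 0" "sum3 (\<lambda>r s t. s * t * w (vC t r) $ 1) =
      0" "sum3 (\<lambda>r s t. r * s * w (vC t r) $ 1) = 0" "sum3 (\<lambda>r s t. r * s * t * w (vC t r) $ 1) = 0"
    by (simp_all add: sum3_expand)
  show "w (vC t r) $ 1 = 2 * phi * (t * y)"
    using sum3_inversion[OF rst, of "\<lambda>r s t. w (vC t r) $ 1"]
    unfolding C1_1 C1_r C1_t C1_rt C1_0 coefs by (simp add: algebra_simps)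
  have D1_1: "sum3 (\<lambda>r s t. w (vD r s) $ 1) = 0"
    using ux0(7) by (simp add: defs algebra_simps)
  have D1_r: "sum3 (\<lambda>r s t. r * w (vD r s) $ 1) = phi * ?e1 - ?e3"
    using diag(4) by (simp add: defs algebra_simps)
  have D1_s: "sum3 (\<lambda>r s t. s * w (vD r s) $ 1) = 2 * ?z"
    using bx2(3) by (simp add: defs algebra_simps)
  have D1_rs: "sum3 (\<lambda>r s t. r * s * w (vD r s) $ 1) = 0"
    using ux1(6) by (simp add: defs algebra_simps)
  have D1_0: "sum3 (\<lambda>r s t. t * w (vD r s) $ 1) = 0" "sum3 (\<lambda>r s t. s * t * w (vD r s) $ 1) =
      0" "sum3 (\<lambda>r s t. r * t * w (vD r s) $ 1) = 0" "sum3 (\<lambda>r s t. r * s * t * w (vD r s) $ 1) = 0"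
    by (simp_all add: sum3_expand)
  show "w (vD r s) $ 1 = r * (phi * e1 - e3) + 2 * (s * z)"
    using sum3_inversion[OF rst, of "\<lambda>r s t. w (vD r s) $ 1"]
    unfolding D1_1 D1_r D1_s D1_rs D1_0 coefs by (simp add: algebra_simps)
  have X1_1: "sum3 (\<lambda>r s t. b (nX s t) $ 1) = 0"
    using ux0(8) by (simp add: defs algebra_simps)
  have X1_s: "sum3 (\<lambda>r s t. s * b (nX s t) $ 1) = 2 * (1 - phi) * ?z"
    using bx2(9) by (simp add: defs algebra_simps)
  have X1_t: "sum3 (\<lambda>r s t. t * b (nX s t) $ 1) = - 2 * ?y"
    using bx1(10) by (simp add: defs algebra_simps)
  have X1_st: "sum3 (\<lambda>r s t. s * t * b (nX s t) $ 1) = 0"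
    using a(7) by (simp add: defs algebra_simps)
  have X1_0: "sum3 (\<lambda>r s t. r * b (nX s t) $ 1) = 0" "sum3 (\<lambda>r s t. r * t * b (nX s t) $ 1) =
      0" "sum3 (\<lambda>r s t. r * s * b (nX s t) $ 1) = 0" "sum3 (\<lambda>r s t. r * s * t * b (nX s t) $ 1) = 0"
    by (simp_all add: sum3_expand)
  show "b (nX s t) $ 1 = - 2 * (t * y) + 2 * (1 - phi) * (s * z)"
    using sum3_inversion[OF rst, of "\<lambda>r s t. b (nX s t) $ 1"]
    unfolding X1_1 X1_s X1_t X1_st X1_0 coefs by (simp add: algebra_simps)
  have Y1_1: "sum3 (\<lambda>r s t. b (nY t r) $ 1) = 0"
    using ux0(9) by (simp add: defs algebra_simps)
  have Y1_t: "sum3 (\<lambda>r s t. t * b (nY t r) $ 1) = 2 * (3 - 2 * phi) * ?y"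
    using bx1(8) by (simp add: defs algebra_simps)
  have Y1_r: "sum3 (\<lambda>r s t. r * b (nY t r) $ 1) = (1 - phi) * ?e1 + (2 - phi) * ?e3"
    using diag(8) by (simp add: defs algebra_simps)
  have Y1_rt: "sum3 (\<lambda>r s t. r * t * b (nY t r) $ 1) = 0"
    using ux2(12) by (simp add: defs algebra_simps)
  have Y1_0: "sum3 (\<lambda>r s t. s * b (nY t r) $ 1) = 0" "sum3 (\<lambda>r s t. s * t * b (nY t r) $ 1) =
      0" "sum3 (\<lambda>r s t. r * s * b (nY t r) $ 1) = 0" "sum3 (\<lambda>r s t. r * s * t * b (nY t r) $ 1) = 0"
    by (simp_all add: sum3_expand)
  show "b (nY t r) $ 1 = r * ((1 - phi) * e1 + (2 - phi) * e3) + 2 * (3 - 2 * phi) * (t * y)"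
    using sum3_inversion[OF rst, of "\<lambda>r s t. b (nY t r) $ 1"]
    unfolding Y1_1 Y1_t Y1_r Y1_rt Y1_0 coefs by (simp add: algebra_simps)
  have Z1_1: "sum3 (\<lambda>r s t. b (nZ r s) $ 1) = 0"
    using ux0(11) by (simp add: defs algebra_simps)
  have Z1_r: "sum3 (\<lambda>r s t. r * b (nZ r s) $ 1) = 2 * (phi - 2) * ?e1"
    using diag(9) by (simp add: defs algebra_simps)
  have Z1_s: "sum3 (\<lambda>r s t. s * b (nZ r s) $ 1) = 4 * (phi - 2) * ?z"
    using bx2(7) by (simp add: defs algebra_simps)
  have Z1_rs: "sum3 (\<lambda>r s t. r * s * b (nZ r s) $ 1) = 0"
    using ux1(10) by (simp add: defs algebra_simps)
  have Z1_0: "sum3 (\<lambda>r s t. t * b (nZ r s) $ 1) = 0" "sum3 (\<lambda>r s t. s * t * b (nZ r s) $ 1) =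
      0" "sum3 (\<lambda>r s t. r * t * b (nZ r s) $ 1) = 0" "sum3 (\<lambda>r s t. r * s * t * b (nZ r s) $ 1) = 0"
    by (simp_all add: sum3_expand)
  show "b (nZ r s) $ 1 = 2 * (phi - 2) * (r * e1) + 4 * (phi - 2) * (s * z)"
    using sum3_inversion[OF rst, of "\<lambda>r s t. b (nZ r s) $ 1"]
    unfolding Z1_1 Z1_r Z1_s Z1_rs Z1_0 coefs by (simp add: algebra_simps)
qed

lemma conj_cyc_3 [simp]: "conj_cyc (conj_cyc (conj_cyc w)) = w"
proof
  fix v
  have "cyc_inv (cyc_inv (cyc_inv v)) = v" "cyc (cyc (cyc u)) = u" for u
    by (simp_all add: vec_eq_iff forall_3)
  then show "conj_cyc (conj_cyc (conj_cyc w)) v = w v"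
    by (simp add: conj_cyc_def)
qed

text \<open>Passing to a rotated copy permutes cyclically the signs, \<open>e1, e2, e3\<close> and
  \<open>x, y, z\<close>, and the third rotation returns to \<open>w\<close>; so three uses of
  \<open>first_components\<close> give all coordinates.\<close>

lemma components:
  assumes flex: "flex_at 0 w b" and gauged: "gauged w"
    and rst: "r \<in> signs" "s \<in> signs" "t \<in> signs"
    and e1: "e1 = coef_e w" and e2: "e2 = coef_e (conj_cyc w)" and e3: "e3 = coef_e (conj_cyc (conj_cyc w))"
    and x: "x = coef_x w" and y: "y = coef_x (conj_cyc w)" and z: "z = coef_x (conj_cyc (conj_cyc w))"
  shows "w (vA r s t) = vector [
      r * e1 + r * s * t * x + phi * (t * y) + (phi + 1) * (s * z),
      s * e2 + s * t * r * y + phi * (r * z) + (phi + 1) * (t * x),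
      t * e3 + t * r * s * z + phi * (s * x) + (phi + 1) * (r * y)]"
    "w (vB s t) = vector [2 * (t * y + s * z), s * (phi * e2 - e1) + 2 * (t * x), 2 * phi * (s * x)]"
    "w (vC t r) = vector [2 * phi * (t * y), 2 * (r * z + t * x), t * (phi * e3 - e2) + 2 * (r * y)]"
    "w (vD r s) = vector [r * (phi * e1 - e3) + 2 * (s * z), 2 * phi * (r * z), 2 * (s * x + r * y)]"
    "b (nX s t) = vector [- 2 * (t * y) + 2 * (1 - phi) * (s * z),
      2 * (phi - 2) * (s * e2) + 4 * (phi - 2) * (t * x),
      t * ((1 - phi) * e3 + (2 - phi) * e2) + 2 * (3 - 2 * phi) * (s * x)]"
    "b (nY t r) = vector [r * ((1 - phi) * e1 + (2 - phi) * e3) + 2 * (3 - 2 * phi) * (t * y),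
      - 2 * (r * z) + 2 * (1 - phi) * (t * x),
      2 * (phi - 2) * (t * e3) + 4 * (phi - 2) * (r * y)]"
    "b (nZ r s) = vector [2 * (phi - 2) * (r * e1) + 4 * (phi - 2) * (s * z),
      s * ((1 - phi) * e2 + (2 - phi) * e1) + 2 * (3 - 2 * phi) * (r * z),
      - 2 * (s * x) + 2 * (1 - phi) * (r * y)]"
  using first_components[OF flex gauged rst e1 e3 x y z]
    first_components[OF flex_at_cyc[OF flex] gauged_cyc[OF gauged] rst(2,3,1) e2 _ y z _,
      unfolded conj_cyc_3, OF e1 x, unfolded conj_cyc_def cyc_nth cyc_inv_points]
    first_components[OF flex_at_cyc[OF flex_at_cyc[OF flex]] gauged_cyc[OF gauged_cyc[OF gauged]]
      rst(3,1,2) e3 _ z _ _, unfolded conj_cyc_3, OF e2 x y, unfolded conj_cyc_def cyc_nth cyc_inv_points]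
  unfolding vec_eq_iff forall_3 vector_3 by (simp_all only: simp_thms)

lemma coef_e_sum:
  assumes flex: "flex_at 0 w b" and gauged: "gauged w"
  shows "coef_e w + coef_e (conj_cyc w) + coef_e (conj_cyc (conj_cyc w)) = 0"
proof -
  have "coef_e (conj_cyc w) = sum3 (\<lambda>r s t. s * w (vA r s t) $ 2) / 8"
    "coef_e (conj_cyc (conj_cyc w)) = sum3 (\<lambda>r s t. t * w (vA r s t) $ 3) / 8"
    by (simp_all add: coef_e_def conj_cyc_def sum3_expand)
  then show ?thesis
    using block_invariant_sums(1)[OF assms] by (simp add: coef_e_def)
qed

section \<open>Second-order rigidity\<close>

text \<open>Up to the factor 12, the quadratic form of \<open>stress_e\<close> on the flexes, with
  \<open>a\<close>, \<open>b\<close> for \<open>e1\<close>, \<open>e2\<close> and with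
  \<open>e3 = - e1 - e2\<close> eliminated.\<close>

definition stress_form :: "real \<Rightarrow> real \<Rightarrow> real \<Rightarrow> real \<Rightarrow> real \<Rightarrow> real" where
  "stress_form a b x y z = (4 - 3*phi)*a\<^sup>2 + 2*(1 - phi)*a*b + (2*phi - 3)*b\<^sup>2
              + 4*(1 - phi)*x\<^sup>2 + 4*(3*phi - 4)*y\<^sup>2 + 4*(3 - 2*phi)*z\<^sup>2"

lemma stress_x_split:
  "stress_x f g = sum3 (\<lambda>r s t. s * t * f (vA r s t) (nX s t))
    + (1 - phi) * sum3 (\<lambda>r s t. s * t * f (vB s t) (nX s t))
    + (phi - 2) * sum3 (\<lambda>r s t. s * t * f (vC t r) (nX s t))
    + (3 - phi) * sum3 (\<lambda>r s t. s * t * f (vA r s t) (nY t r))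
    + (1 - 2 * phi) * sum3 (\<lambda>r s t. s * t * f (vD r s) (nY t r))
    + (4 - 3 * phi) * sum3 (\<lambda>r s t. s * t * f (vA r s t) (nZ r s))
    + (3 - phi) * sum3 (\<lambda>r s t. s * t * f (vB s t) (nZ r s))
    - sum3 (\<lambda>r s t. s * t * g (vA r s t) (vB s t))
    + (3 * phi - 5) * sum3 (\<lambda>r s t. s * t * g (vA r s t) (vC t r))
    + (4 - 3 * phi) * sum3 (\<lambda>r s t. s * t * g (vA r s t) (vD r s))"
  unfolding stress_x_def sum3_expand by (simp add: algebra_simps)

lemma stress_e_split:
  "stress_e f g = sum3 (\<lambda>r s t. f (vA r s t) (nX s t))
    + (1 - phi) * sum3 (\<lambda>r s t. f (vB s t) (nX s t))
    + (phi - 2) * sum3 (\<lambda>r s t. f (vC t r) (nX s t))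
    - sum3 (\<lambda>r s t. f (vA r s t) (nZ r s))
    + (phi - 1) * sum3 (\<lambda>r s t. f (vD r s) (nZ r s))
    + (2 - phi) * sum3 (\<lambda>r s t. f (vB s t) (nZ r s))
    + (2 - phi) * sum3 (\<lambda>r s t. g (vA r s t) (vC t r))
    + (phi - 2) * sum3 (\<lambda>r s t. g (vA r s t) (vD r s))
    + (phi - 1) / 4 * sum3 (\<lambda>r s t. g (vB s t) (vB s (-t)))
    + (2 * phi - 3) / 4 * sum3 (\<lambda>r s t. g (vC t r) (vC t (-r)))
    + (4 - 3 * phi) / 4 * sum3 (\<lambda>r s t. g (vD r s) (vD r (-s)))"
  unfolding stress_e_def sum3_def sum_distrib_left sum.distrib[symmetric] sum_subtractf[symmetric] ..

text \<open>The parameters \<open>x\<close>, \<open>y\<close>, \<open>z\<close> belong to the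
  characters \<open>s * t\<close>, \<open>r * t\<close>, \<open>r * s\<close>, and the
  \<open>e\<close> parameters to the trivial one. The stress has character \<open>s * t\<close>, so
  only the monomials \<open>e1 * x\<close>, \<open>e2 * x\<close> and \<open>y * z\<close> survive.
  The contributions of the orbits are evaluated one at a time.\<close>

lemma second_order_x:
  assumes flex: "flex_at 0 w b" and gauged: "gauged w" and stress_forms_vanish: "stress_forms_vanish w b"
    and e1: "e1 = coef_e w" and e2: "e2 = coef_e (conj_cyc w)"
    and x: "x = coef_x w" and y: "y = coef_x (conj_cyc w)" and z: "z = coef_x (conj_cyc (conj_cyc w))"
  shows "e1 * x + (3 - phi) * (e2 * x + y * z) = 0"
proof -
  have e3: "- e1 - e2 = coef_e (conj_cyc (conj_cyc w))"
    using coef_e_sum[OF flex gauged] e1 e2 by simp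
  note c = components(1)[OF flex gauged _ _ _ e1 e2 e3 x y z]
    components(2,5)[OF flex gauged signs_simps(1) _ _ e1 e2 e3 x y z]
    components(3,6)[OF flex gauged _ signs_simps(1) _ e1 e2 e3 x y z]
    components(4,7)[OF flex gauged _ _ signs_simps(1) e1 e2 e3 x y z]
  have AX: "sum3 (\<lambda>r s t. s * t * (w (vA r s t) \<bullet> b (nX s t))) =
      (32 * phi - 40) * (e1 * x) + (72 * phi - 128) * (e2 * x) - (32 + 16 * phi) * (y * z)"
    unfolding sum3_expand
    by (simp only: c signs_simps minus_minus inner_3 vector_3 vector_minus_component) (simp add: algebra_simps phi_simps)
  have BX: "sum3 (\<lambda>r s t. s * t * (w (vB s t) \<bullet> b (nX s t))) =
      (80 - 32 * phi) * (e1 * x) + (16 * phi - 32) * (e2 * x) - 32 * phi * (y * z)"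
    unfolding sum3_expand
    by (simp only: c signs_simps minus_minus inner_3 vector_3 vector_minus_component) (simp add: algebra_simps phi_simps)
  have CX: "sum3 (\<lambda>r s t. s * t * (w (vC t r) \<bullet> b (nX s t))) =
      (32 - 16 * phi) * (e1 * x) + (48 * phi - 80) * (e2 * x) - 32 * (y * z)"
    unfolding sum3_expand
    by (simp only: c signs_simps minus_minus inner_3 vector_3 vector_minus_component) (simp add: algebra_simps phi_simps)
  have AY: "sum3 (\<lambda>r s t. s * t * (w (vA r s t) \<bullet> b (nY t r))) =
      (16 * phi - 24) * (e1 * x) + (8 * phi - 16) * (e2 * x) + (16 * phi - 64) * (y * z)"
    unfolding sum3_expand
    by (simp only: c signs_simps minus_minus inner_3 vector_3 vector_minus_component) (simp add: algebra_simps phi_simps)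
  have DY: "sum3 (\<lambda>r s t. s * t * (w (vD r s) \<bullet> b (nY t r))) =
      (64 - 32 * phi) * (e1 * x) + (64 - 32 * phi) * (e2 * x) + (96 - 64 * phi) * (y * z)"
    unfolding sum3_expand
    by (simp only: c signs_simps minus_minus inner_3 vector_3 vector_minus_component) (simp add: algebra_simps phi_simps)
  have AZ: "sum3 (\<lambda>r s t. s * t * (w (vA r s t) \<bullet> b (nZ r s))) =
      (16 * phi - 8) * (e1 * x) + (16 - 8 * phi) * (e2 * x) + (96 - 80 * phi) * (y * z)"
    unfolding sum3_expand
    by (simp only: c signs_simps minus_minus inner_3 vector_3 vector_minus_component) (simp add: algebra_simps phi_simps)
  have BZ: "sum3 (\<lambda>r s t. s * t * (w (vB s t) \<bullet> b (nZ r s))) =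
      (32 - 16 * phi) * (e1 * x) + (16 - 16 * phi) * (e2 * x) + (64 * phi - 128) * (y * z)"
    unfolding sum3_expand
    by (simp only: c signs_simps minus_minus inner_3 vector_3 vector_minus_component) (simp add: algebra_simps phi_simps)
  have AB: "sum3 (\<lambda>r s t. s * t * ((w (vA r s t) - w (vB s t)) \<bullet> (w (vA r s t) - w (vB s t)) / 2)) =
      16 * phi * (e1 * x) + (16 * phi - 16) * (e2 * x) + 32 * (y * z)"
    unfolding sum3_expand
    by (simp only: c signs_simps minus_minus inner_3 vector_3 vector_minus_component) (simp add: algebra_simps phi_simps)
  have AC: "sum3 (\<lambda>r s t. s * t * ((w (vA r s t) - w (vC t r)) \<bullet> (w (vA r s t) - w (vC t r)) / 2)) =
      16 * (e1 * x) + 16 * phi * (e2 * x) - 32 * (y * z)"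
    unfolding sum3_expand
    by (simp only: c signs_simps minus_minus inner_3 vector_3 vector_minus_component) (simp add: algebra_simps phi_simps)
  have AD: "sum3 (\<lambda>r s t. s * t * ((w (vA r s t) - w (vD r s)) \<bullet> (w (vA r s t) - w (vD r s)) / 2)) =
      (16 - 16 * phi) * (e1 * x) + 16 * (e2 * x)"
    unfolding sum3_expand
    by (simp only: c signs_simps minus_minus inner_3 vector_3 vector_minus_component) (simp add: algebra_simps phi_simps)
  have "0 = stress_x (\<lambda>v n. w v \<bullet> b n) (\<lambda>v v'. (w v - w v') \<bullet> (w v - w v') / 2)"
    using stress_forms_vanish by (simp add: stress_forms_vanish_def Let_def)
  also have "\<dots> = sum3 (\<lambda>r s t. s * t * (w (vA r s t) \<bullet> b (nX s t)))
    + (1 - phi) * sum3 (\<lambda>r s t. s * t * (w (vB s t) \<bullet> b (nX s t)))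
    + (phi - 2) * sum3 (\<lambda>r s t. s * t * (w (vC t r) \<bullet> b (nX s t)))
    + (3 - phi) * sum3 (\<lambda>r s t. s * t * (w (vA r s t) \<bullet> b (nY t r)))
    + (1 - 2 * phi) * sum3 (\<lambda>r s t. s * t * (w (vD r s) \<bullet> b (nY t r)))
    + (4 - 3 * phi) * sum3 (\<lambda>r s t. s * t * (w (vA r s t) \<bullet> b (nZ r s)))
    + (3 - phi) * sum3 (\<lambda>r s t. s * t * (w (vB s t) \<bullet> b (nZ r s)))
    - sum3 (\<lambda>r s t. s * t * ((w (vA r s t) - w (vB s t)) \<bullet> (w (vA r s t) - w (vB s t)) / 2))
    + (3 * phi - 5) * sum3 (\<lambda>r s t. s * t * ((w (vA r s t) - w (vC t r)) \<bullet> (w (vA r s t) - w (vC t r)) / 2))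
    + (4 - 3 * phi) * sum3 (\<lambda>r s t. s * t * ((w (vA r s t) - w (vD r s)) \<bullet> (w (vA r s t) - w (vD r s)) / 2))"
    unfolding stress_x_split by simp
  also have "\<dots> = 96 * (1 - phi) * (e1 * x + (3 - phi) * (e2 * x + y * z))"
    unfolding AX BX CX AY DY AZ BZ AB AC AD
        by (simp add: stress_form_def power2_eq_square field_simps phi_simps)
  finally show ?thesis using phi_bounds by simp
qed

text \<open>The stress is invariant, so its form contains only products of the \<open>e\<close>
  parameters and the squares of \<open>x\<close>, \<open>y\<close>, \<open>z\<close>.\<close>

lemma second_order_e:
  assumes flex: "flex_at 0 w b" and gauged: "gauged w" and stress_forms_vanish: "stress_forms_vanish w b"
    and e1: "e1 = coef_e w" and e2: "e2 = coef_e (conj_cyc w)"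
    and x: "x = coef_x w" and y: "y = coef_x (conj_cyc w)" and z: "z = coef_x (conj_cyc (conj_cyc w))"
  shows "stress_form e1 e2 x y z = 0"
proof -
  have e3: "- e1 - e2 = coef_e (conj_cyc (conj_cyc w))"
    using coef_e_sum[OF flex gauged] e1 e2 by simp
  note c = components(1)[OF flex gauged _ _ _ e1 e2 e3 x y z]
    components(2,5)[OF flex gauged signs_simps(1) _ _ e1 e2 e3 x y z]
    components(3,6)[OF flex gauged _ signs_simps(1) _ e1 e2 e3 x y z]
    components(4,7)[OF flex gauged _ _ signs_simps(1) e1 e2 e3 x y z]
  have AX: "sum3 (\<lambda>r s t. (w (vA r s t) \<bullet> b (nX s t))) =
      (8 - 8 * phi) * (e1 * e1) - 8 * phi * (e1 * e2) + (16 * phi - 40) * (e2 * e2) + (16 * phi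
          - 64) * (x * x) - 16 * phi * (y * y) - 16 * phi * (z * z)"
    unfolding sum3_expand
    by (simp only: c signs_simps minus_minus inner_3 vector_3 vector_minus_component) (simp add: algebra_simps phi_simps)
  have BX: "sum3 (\<lambda>r s t. (w (vB s t) \<bullet> b (nX s t))) =
      (32 - 16 * phi) * (e1 * e2) + (16 - 16 * phi) * (e2 * e2) + (96 * phi - 192) * (x * x)
          - 32 * (y * y) + (32 - 32 * phi) * (z * z)"
    unfolding sum3_expand
    by (simp only: c signs_simps minus_minus inner_3 vector_3 vector_minus_component) (simp add: algebra_simps phi_simps)
  have CX: "sum3 (\<lambda>r s t. (w (vC t r) \<bullet> b (nX s t))) =
      - 8 * (e1 * e1) - 16 * phi * (e1 * e2) - (8 + 8 * phi) * (e2 * e2) + (64 * phi - 128) * (x * x)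
          - 32 * phi * (y * y)"
    unfolding sum3_expand
    by (simp only: c signs_simps minus_minus inner_3 vector_3 vector_minus_component) (simp add: algebra_simps phi_simps)
  have AZ: "sum3 (\<lambda>r s t. (w (vA r s t) \<bullet> b (nZ r s))) =
      (16 * phi - 32) * (e1 * e1) + (16 - 8 * phi) * (e1 * e2) + (8 - 8 * phi) * (e2 * e2)
          - 16 * phi * (x * x) - 16 * phi * (y * y) + (16 * phi - 64) * (z * z)"
    unfolding sum3_expand
    by (simp only: c signs_simps minus_minus inner_3 vector_3 vector_minus_component) (simp add: algebra_simps phi_simps)
  have DZ: "sum3 (\<lambda>r s t. (w (vD r s) \<bullet> b (nZ r s))) =
      - 16 * (e1 * e1) + (16 * phi - 32) * (e1 * e2) - 32 * (x * x) + (32 - 32 * phi) * (y * y)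
          + (96 * phi - 192) * (z * z)"
    unfolding sum3_expand
    by (simp only: c signs_simps minus_minus inner_3 vector_3 vector_minus_component) (simp add: algebra_simps phi_simps)
  have BZ: "sum3 (\<lambda>r s t. (w (vB s t) \<bullet> b (nZ r s))) =
      (8 * phi - 16) * (e1 * e1) + (16 * phi - 16) * (e1 * e2) - 8 * (e2 * e2) - 32 * phi * (x * x)
          + (64 * phi - 128) * (z * z)"
    unfolding sum3_expand
    by (simp only: c signs_simps minus_minus inner_3 vector_3 vector_minus_component) (simp add: algebra_simps phi_simps)
  have AC: "sum3 (\<lambda>r s t. ((w (vA r s t) - w (vC t r)) \<bullet> (w (vA r s t) - w (vC t r)) / 2)) =
      (12 - 4 * phi) * (e1 * e1) + 8 * (e1 * e2) + (8 + 4 * phi) * (e2 * e2) + 16 * (x * x)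
          + 16 * (y * y) + 32 * (z * z)"
    unfolding sum3_expand
    by (simp only: c signs_simps minus_minus inner_3 vector_3 vector_minus_component) (simp add: algebra_simps phi_simps)
  have AD: "sum3 (\<lambda>r s t. ((w (vA r s t) - w (vD r s)) \<bullet> (w (vA r s t) - w (vD r s)) / 2)) =
      (8 + 4 * phi) * (e1 * e1) + (8 + 8 * phi) * (e1 * e2) + 12 * (e2 * e2) + 32 * (x * x)
          + 16 * (y * y) + 16 * (z * z)"
    unfolding sum3_expand
    by (simp only: c signs_simps minus_minus inner_3 vector_3 vector_minus_component) (simp add: algebra_simps phi_simps)
  have BB: "sum3 (\<lambda>r s t. ((w (vB s t) - w (vB s (-t))) \<bullet> (w (vB s t) - w (vB s (-t))) / 2)) =
      64 * (x * x) + 64 * (y * y)"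
    unfolding sum3_expand
    by (simp only: c signs_simps minus_minus inner_3 vector_3 vector_minus_component) (simp add: algebra_simps phi_simps)
  have CC: "sum3 (\<lambda>r s t. ((w (vC t r) - w (vC t (-r))) \<bullet> (w (vC t r) - w (vC t (-r))) / 2)) =
      64 * (y * y) + 64 * (z * z)"
    unfolding sum3_expand
    by (simp only: c signs_simps minus_minus inner_3 vector_3 vector_minus_component) (simp add: algebra_simps phi_simps)
  have DD: "sum3 (\<lambda>r s t. ((w (vD r s) - w (vD r (-s))) \<bullet> (w (vD r s) - w (vD r (-s))) / 2)) =
      64 * (x * x) + 64 * (z * z)"
    unfolding sum3_expand
    by (simp only: c signs_simps minus_minus inner_3 vector_3 vector_minus_component) (simp add: algebra_simps phi_simps)
  have "0 = stress_e (\<lambda>v n. w v \<bullet> b n) (\<lambda>v v'. (w v - w v') \<bullet> (w v - w v') / 2)"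
    using stress_forms_vanish by (simp add: stress_forms_vanish_def Let_def)
  also have "\<dots> = sum3 (\<lambda>r s t. (w (vA r s t) \<bullet> b (nX s t)))
    + (1 - phi) * sum3 (\<lambda>r s t. (w (vB s t) \<bullet> b (nX s t)))
    + (phi - 2) * sum3 (\<lambda>r s t. (w (vC t r) \<bullet> b (nX s t)))
    - sum3 (\<lambda>r s t. (w (vA r s t) \<bullet> b (nZ r s)))
    + (phi - 1) * sum3 (\<lambda>r s t. (w (vD r s) \<bullet> b (nZ r s)))
    + (2 - phi) * sum3 (\<lambda>r s t. (w (vB s t) \<bullet> b (nZ r s)))
    + (2 - phi) * sum3 (\<lambda>r s t. ((w (vA r s t) - w (vC t r)) \<bullet> (w (vA r s t) - w (vC t r)) / 2))
    + (phi - 2) * sum3 (\<lambda>r s t. ((w (vA r s t) - w (vD r s)) \<bullet> (w (vA r s t) - w (vD r s)) / 2))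
    + (phi - 1) / 4 * sum3 (\<lambda>r s t. ((w (vB s t) - w (vB s (-t))) \<bullet> (w (vB s t) - w (vB s (-t))) / 2))
    + (2 * phi - 3) / 4 * sum3 (\<lambda>r s t. ((w (vC t r) - w (vC t (-r))) \<bullet> (w (vC t r) - w (vC t (-r))) / 2))
    + (4 - 3 * phi) / 4 * sum3 (\<lambda>r s t. ((w (vD r s) - w (vD r (-s))) \<bullet> (w (vD r s) - w (vD r (-s))) / 2))"
    unfolding stress_e_split by simp
  also have "\<dots> = 12 * stress_form e1 e2 x y z"
    unfolding AX BX CX AZ DZ BZ AC AD BB CC DD
        by (simp add: stress_form_def power2_eq_square field_simps phi_simps)
  finally show ?thesis using phi_bounds by simp
qed

text \<open>The case in which at most one of the three axis parameters is nonzero. If it is zero,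
  \<open>q1\<close> confines \<open>(a, b)\<close> to two lines and \<open>q2\<close> is definite on
  each; otherwise \<open>l\<close> confines \<open>(a, b)\<close> to one line, on which the form in
  \<open>q2\<close> is negative definite.\<close>

lemma second_order_trivial_aux:
  assumes e: "a + b + c = 0" and l: "(a + (3 - phi) * b) * x = 0"
    and q1: "stress_form a b x 0 0 = 0" and q2: "stress_form b c 0 0 x = 0"
  shows "a = 0 \<and> b = 0 \<and> c = 0 \<and> x = 0"
proof (cases "x = 0")
  case True
  have c: "c = - a - b" using e by simp
  \<comment> \<open>A quarter of the discriminant is \<open>20 - 12 * phi\<close>, the square of
    \<open>2 * (2 - phi)\<close>, so the form splits over the field generated by \<open>phi\<close>.
    The 5 clears the denominator of \<open>1 / (4 - 3 * phi)\<close>.\<close>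
  have "5 * stress_form a b 0 0 0 = (4 - 3*phi) * ((a + phi * b) * (5*a - (3*phi - 4) * b))"
    unfolding stress_form_def by (simp add: power2_eq_square algebra_simps phi_simps)
  then have "a + phi * b = 0 \<or> 5*a - (3*phi - 4) * b = 0"
    using q1 True phi_bounds by auto
  then show ?thesis
  proof
    assume "a + phi * b = 0"
    then have a: "a = - (phi * b)" by simp
    have "stress_form b c 0 0 0 = (4 * phi - 8) * (b * b)"
      unfolding stress_form_def c a by (simp add: power2_eq_square algebra_simps phi_simps)
    then show ?thesis using q2 True a c phi_bounds by auto
  next
    assume "5*a - (3*phi - 4) * b = 0"
    define d where "d = b / 5"
    have b: "b = 5 * d" and a: "a = (3*phi - 4) * d"
      using \<open>5*a - (3*phi - 4) * b = 0\<close> by (simp_all add: d_def)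
    have "stress_form b c 0 0 0 = (120 - 60 * phi) * (d * d)"
      unfolding stress_form_def c a b by (simp add: power2_eq_square algebra_simps phi_simps)
    then show ?thesis using q2 True a b c phi_bounds by auto
  qed
next
  case False
  have a: "a = - ((3 - phi) * b)" using l False by (simp add: eq_neg_iff_add_eq_0)
  have c: "c = - a - b" using e by simp
  have "- stress_form b c 0 0 x = (11 - 6 * phi) * (b * b) + 4 * (2 * phi - 3) * (x * x)"
    unfolding stress_form_def c a by (simp add: power2_eq_square algebra_simps phi_simps)
  moreover have "(11 - 6 * phi) * (b * b) \<ge> 0" "4 * (2 * phi - 3) * (x * x) > 0"
    using phi_bounds False by (auto intro!: mult_nonneg_nonneg mult_pos_pos simp: zero_less_mult_iff)
  ultimately show ?thesis using q2 by linarith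
qed

text \<open>If \<open>x y z \<noteq> 0\<close>, the coefficients \<open>a + k b\<close>, \<open>b + k c\<close>, \<open>c + k a\<close> with \<open>k = 3 - phi\<close> all have the sign
  of \<open>- x y z\<close>, but their sum is \<open>0\<close>.\<close>

lemma second_order_trivial:
  assumes e: "a + b + c = 0"
    and x: "a * x + (3 - phi) * (b * x + y * z) = 0"
    and y: "b * y + (3 - phi) * (c * y + z * x) = 0"
    and z: "c * z + (3 - phi) * (a * z + x * y) = 0"
    and q: "stress_form a b x y z = 0" "stress_form b c y z x = 0" "stress_form c a z x y = 0"
  shows "a = 0 \<and> b = 0 \<and> c = 0 \<and> x = 0 \<and> y = 0 \<and> z = 0"
proof -
  define k where "k = 3 - phi"
  have k: "k \<noteq> 0" using phi_bounds by (simp add: k_def)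
  have xyz: "x * y * z = 0"
  proof (rule ccontr)
    assume nz: "x * y * z \<noteq> 0"
    define m where "m = - k * (x * y * z)"
    have "m \<noteq> 0" using nz k by (simp add: m_def)
    have "(a + k * b) * x\<^sup>2 = m" "(b + k * c) * y\<^sup>2 = m" "(c + k * a) * z\<^sup>2 = m"
      using x y z unfolding m_def k_def[symmetric] by algebra+
    then have "a + k * b = m / x\<^sup>2" "b + k * c = m / y\<^sup>2" "c + k * a = m / z\<^sup>2"
      using nz by (auto simp: field_simps)
    moreover have "(a + k * b) + (b + k * c) + (c + k * a) = 0"
      using e by algebra
    ultimately have "m * (1 / x\<^sup>2 + 1 / y\<^sup>2 + 1 / z\<^sup>2) = 0"
      by (simp add: field_simps)
    moreover have "1 / x\<^sup>2 + 1 / y\<^sup>2 + 1 / z\<^sup>2 > 0"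
      using nz by (intro add_pos_pos) auto
    ultimately show False using \<open>m \<noteq> 0\<close> by simp
  qed
  have e': "b + c + a = 0" "c + a + b = 0" using e by simp_all
  \<comment> \<open>If for instance \<open>x = 0\<close>, the first equation reduces to
    \<open>k * (y * z) = 0\<close>, so a second parameter vanishes too.\<close>
  consider "x = 0" "y = 0" | "y = 0" "z = 0" | "z = 0" "x = 0"
    using xyz x y z k by (fold k_def) fastforce
  then show ?thesis
  proof cases
    case 1
    then show ?thesis
      using second_order_trivial_aux[OF e'(2), of z] z q by (simp add: algebra_simps)
  next
    case 2
    then show ?thesis
      using second_order_trivial_aux[OF e, of x] x q by (simp add: algebra_simps)
  next
    case 3
    then show ?thesis
      using second_order_trivial_aux[OF e'(1), of y] y q by (simp add: algebra_simps)
  qed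
qed

text \<open>The conclusion about \<open>b\<close> matters as well: the increments of vertices and
  normals are normalized together, so both have to vanish in the limit for a contradiction.\<close>

theorem second_order_rigid:
  assumes flex: "flex_at 0 w b" and gauged: "gauged w"
    and stress_forms_vanish: "stress_forms_vanish w b" "stress_forms_vanish (conj_cyc w) (conj_cyc b)"
      "stress_forms_vanish (conj_cyc (conj_cyc w)) (conj_cyc (conj_cyc b))"
  shows "\<And>v. v \<in> dverts \<Longrightarrow> w v = 0" "\<And>n. n \<in> dnormals \<Longrightarrow> b n = 0"
proof -
  note flex1 = flex_at_cyc[OF flex] and gauged1 = gauged_cyc[OF gauged]
  note flex2 = flex_at_cyc[OF flex1] and gauged2 = gauged_cyc[OF gauged1]
  note 0 = second_order_trivial[OF coef_e_sum[OF flex gauged]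
      second_order_x[OF flex gauged stress_forms_vanish(1) refl refl refl refl refl]
      second_order_x[OF flex1 gauged1 stress_forms_vanish(2) refl refl refl refl refl, unfolded conj_cyc_3]
      second_order_x[OF flex2 gauged2 stress_forms_vanish(3) refl refl refl refl refl, unfolded conj_cyc_3]
      second_order_e[OF flex gauged stress_forms_vanish(1) refl refl refl refl refl]
      second_order_e[OF flex1 gauged1 stress_forms_vanish(2) refl refl refl refl refl, unfolded conj_cyc_3]
      second_order_e[OF flex2 gauged2 stress_forms_vanish(3) refl refl refl refl refl, unfolded conj_cyc_3]]
  have z: "vector [0, 0, 0] = (0 :: real^3)"
    by (simp add: vec_eq_iff forall_3)
  note c = components[OF flex gauged _ _ _ refl refl refl refl refl refl]
  note c = c(1) c(2,5)[OF signs_simps(1)] c(3,6)[OF _ signs_simps(1)] c(4,7)[OF _ _ signs_simps(1)]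
  show "\<And>v. v \<in> dverts \<Longrightarrow> w v = 0"
    by (elim dverts_cases) (simp_all add: c 0 z)
  show "\<And>n. n \<in> dnormals \<Longrightarrow> b n = 0"
    by (elim dnormals_cases) (simp_all add: c 0 z)
qed

section \<open>Local rigidity\<close>

text \<open>Only the values on a finite set matter, so successive subsequences suffice and no
  compactness in a function space is involved.\<close>

lemma finite_family_convergent_subsequence:
  fixes f :: "nat \<Rightarrow> 'i \<Rightarrow> 'a :: heine_borel"
  assumes "finite I" and "\<And>i. i \<in> I \<Longrightarrow> bounded (range (\<lambda>k. f k i))"
  shows "\<exists>l \<sigma>. strict_mono \<sigma> \<and> (\<forall>i\<in>I. (\<lambda>k. f (\<sigma> k) i) \<longlonglongrightarrow> l i)"
  using assms
proof (induction I)
  case empty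
  then show ?case using strict_mono_id by auto
next
  case (insert j I)
  then obtain l \<sigma> where \<sigma>: "strict_mono \<sigma>" "\<forall>i\<in>I. (\<lambda>k. f (\<sigma> k) i) \<longlonglongrightarrow> l i"
    by auto
  have "bounded (range (\<lambda>k. f (\<sigma> k) j))"
    by (rule bounded_subset[OF insert.prems[of j]]) auto
  then obtain m \<tau> where \<tau>: "strict_mono \<tau>" "((\<lambda>k. f (\<sigma> k) j) \<circ> \<tau>) \<longlonglongrightarrow> m"
    using bounded_imp_convergent_subsequence by blast
  have "(\<lambda>k. f ((\<sigma> \<circ> \<tau>) k) i) \<longlonglongrightarrow> (l(j := m)) i" if "i \<in> insert j I" for i
    using that \<tau> \<sigma>(2) LIMSEQ_subseq_LIMSEQ[OF _ \<tau>(1), of "\<lambda>k. f (\<sigma> k) i" "l i"]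
    by (cases "i = j") (auto simp: o_def)
  then show ?case
    using strict_mono_o[OF \<sigma>(1) \<tau>(1)] by (intro exI[of _ "l(j := m)"] exI[of _ "\<sigma> \<circ> \<tau>"]) blast
qed

lemma flex_at_scale:
  assumes flex: "flex_at 1 (\<lambda>v. h *\<^sub>R w v) (\<lambda>n. h *\<^sub>R b n)" and "h \<noteq> 0"
  shows "flex_at h w b"
  unfolding flex_at_def
proof (intro conjI ballI impI)
  fix v n assume "v \<in> dverts" "n \<in> dnormals" "v \<bullet> n = 1"
  from flex_at_inc[OF flex this] have "h * (w v \<bullet> n + v \<bullet> b n + h * (w v \<bullet> b n)) = 0"
    by (simp add: algebra_simps)
  then show "w v \<bullet> n + v \<bullet> b n + h * (w v \<bullet> b n) = 0"
    using \<open>h \<noteq> 0\<close> by (simp only: mult_eq_0_iff simp_thms)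
next
  fix v v' assume "v \<in> dverts" "v' \<in> dverts" "v \<bullet> v' = sqrt 5"
  from flex_at_edge[OF flex this]
  have "h * ((v - v') \<bullet> (w v - w v') + h * ((w v - w v') \<bullet> (w v - w v') / 2)) = 0"
    unfolding scaleR_right_diff_distrib[symmetric] inner_scaleR_left inner_scaleR_right
    by (simp only: distrib_left mult_1 times_divide_eq_right)
  then show "(v - v') \<bullet> (w v - w v') + h * ((w v - w v') \<bullet> (w v - w v') / 2) = 0"
    using \<open>h \<noteq> 0\<close> by (simp only: mult_eq_0_iff simp_thms)
qed

lemma LIMSEQ_zero_unique:
  fixes l :: "'a :: real_normed_vector"
  assumes "f \<longlonglongrightarrow> l" "\<And>k. f k = 0" shows "l = 0"
proof -
  have "f = (\<lambda>_. 0)" using assms(2) by auto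
  then show ?thesis using assms(1) by (simp add: LIMSEQ_const_iff)
qed

lemma gauged_scale: "gauged w \<Longrightarrow> gauged (\<lambda>v. c *\<^sub>R w v)"
  by (simp add: gauged_def cross_mult_left flip: scaleR_sum_right)

context
  fixes w b :: "nat \<Rightarrow> real^3 \<Rightarrow> real^3" and u c
  assumes w: "\<And>v. v \<in> dverts \<Longrightarrow> (\<lambda>k. w k v) \<longlonglongrightarrow> u v"
    and b: "\<And>n. n \<in> dnormals \<Longrightarrow> (\<lambda>k. b k n) \<longlonglongrightarrow> c n"
begin

lemma flex_at_limit:
  assumes "h \<longlonglongrightarrow> h'" "\<And>k. flex_at (h k) (w k) (b k)"
  shows "flex_at h' u c"
  unfolding flex_at_def
proof (intro conjI ballI impI)
  fix v n assume "v \<in> dverts" "n \<in> dnormals" "v \<bullet> n = 1"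
  then have "(\<lambda>k. w k v \<bullet> n + v \<bullet> b k n + h k * (w k v \<bullet> b k n)) \<longlonglongrightarrow> u v \<bullet> n + v \<bullet> c n + h' * (u v \<bullet> c n)"
    by (intro tendsto_intros w b assms)
  moreover have "\<And>k. w k v \<bullet> n + v \<bullet> b k n + h k * (w k v \<bullet> b k n) = 0"
    using flex_at_inc[OF assms(2)] \<open>v \<in> dverts\<close> \<open>n \<in> dnormals\<close> \<open>v \<bullet> n = 1\<close> .
  ultimately show "u v \<bullet> n + v \<bullet> c n + h' * (u v \<bullet> c n) = 0"
    by (rule LIMSEQ_zero_unique)
next
  fix v v' assume v: "v \<in> dverts" "v' \<in> dverts" "v \<bullet> v' = sqrt 5"
  have "(\<lambda>k. (v - v') \<bullet> (w k v - w k v') + h k * ((w k v - w k v') \<bullet> (w k v - w k v') / 2)) \<longlonglongrightarrow>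
      (v - v') \<bullet> (u v - u v') + h' * ((u v - u v') \<bullet> (u v - u v') / 2)"
    by (intro tendsto_intros w v assms) simp
  moreover have "\<And>k. (v - v') \<bullet> (w k v - w k v') + h k * ((w k v - w k v') \<bullet> (w k v - w k v') / 2) = 0"
    using flex_at_edge[OF assms(2) v] .
  ultimately show "(v - v') \<bullet> (u v - u v') + h' * ((u v - u v') \<bullet> (u v - u v') / 2) = 0"
    by (rule LIMSEQ_zero_unique)
qed

lemma gauged_limit:
  assumes "\<And>k. gauged (w k)" shows "gauged u"
proof -
  have "(\<lambda>k. \<Sum>v\<in>dverts. w k v) \<longlonglongrightarrow> (\<Sum>v\<in>dverts. u v)"
    by (intro tendsto_intros w)
  moreover have "bounded_linear (\<lambda>x. cross3 x v)" for v
    unfolding linear_conv_bounded_linear[symmetric]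
    by (rule linearI) (simp_all add: cross_add_left cross_mult_left)
  then have "(\<lambda>k. \<Sum>v\<in>dverts. cross3 (w k v) v) \<longlonglongrightarrow> (\<Sum>v\<in>dverts. cross3 (u v) v)"
    by (intro tendsto_sum bounded_linear.tendsto[of "\<lambda>x. cross3 x _"] w)
  ultimately show ?thesis
    using assms LIMSEQ_zero_unique unfolding gauged_def by blast
qed

lemma stress_forms_vanish_limit:
  assumes "\<And>k. stress_forms_vanish (w k) (b k)" shows "stress_forms_vanish u c"
proof -
  let ?f = "\<lambda>w b v n. w v \<bullet> b n :: real" and ?g = "\<lambda>w v v'. (w v - w v') \<bullet> (w v - w v') / 2 :: real"
  have "(\<lambda>k. stress_x (?f (w k) (b k)) (?g (w k))) \<longlonglongrightarrow> stress_x (?f u c) (?g u)"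
    and "(\<lambda>k. stress_e (?f (w k) (b k)) (?g (w k))) \<longlonglongrightarrow> stress_e (?f u c) (?g u)"
    unfolding stress_x_def stress_e_def sum3_def by (intro tendsto_intros w b; simp)+
  then show ?thesis
    using assms LIMSEQ_zero_unique unfolding stress_forms_vanish_def Let_def by blast
qed

lemma conj_cyc_limit:
  "v \<in> dverts \<Longrightarrow> (\<lambda>k. conj_cyc (w k) v) \<longlonglongrightarrow> conj_cyc u v"
  "n \<in> dnormals \<Longrightarrow> (\<lambda>k. conj_cyc (b k) n) \<longlonglongrightarrow> conj_cyc c n"
  unfolding conj_cyc_def
  using linear_conv_bounded_linear cyc_linear
  by (auto intro!: bounded_linear.tendsto[of cyc] w b cyc_inv_dverts cyc_inv_dnormals)

end

theorem no_small_flex: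
  fixes W B :: "nat \<Rightarrow> real^3 \<Rightarrow> real^3"
  assumes flex: "\<And>k. flex_at 1 (W k) (B k)" and gauged: "\<And>k. gauged (W k)"
    and W: "\<And>v. v \<in> dverts \<Longrightarrow> (\<lambda>k. W k v) \<longlonglongrightarrow> 0"
    and B: "\<And>n. n \<in> dnormals \<Longrightarrow> (\<lambda>k. B k n) \<longlonglongrightarrow> 0"
  shows "\<exists>k. \<forall>v\<in>dverts. W k v = 0"
proof (rule ccontr)
  assume nz: "\<not> ?thesis"
  \<comment> \<open>The scale measures vertices and normals together, so that the rescaled pair has
    total norm exactly 1, a condition that survives the limit.\<close>
  define h where "h k = (\<Sum>v\<in>dverts. norm (W k v)) + (\<Sum>n\<in>dnormals. norm (B k n))" for k
  have bounds: "v \<in> dverts \<Longrightarrow> norm (W k v) \<le> h k" "n \<in> dnormals \<Longrightarrow> norm (B k n) \<le> h k" for k v n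
    using member_le_sum[OF _ _ finite_dverts, of v "\<lambda>v. norm (W k v)"] member_le_sum[OF _ _ finite_dnormals, of n "\<lambda>n. norm (B k n)"]
      sum_nonneg[of dverts "\<lambda>v. norm (W k v)"] sum_nonneg[of dnormals "\<lambda>n. norm (B k n)"]
    unfolding h_def by fastforce+
  have hpos: "h k > 0" for k
  proof -
    obtain v where "v \<in> dverts" "W k v \<noteq> 0" using nz by blast
    then show ?thesis using bounds(1)[of v k] by (meson less_le_trans zero_less_norm_iff)
  qed
  have h0: "h \<longlonglongrightarrow> 0"
  proof -
    have "h \<longlonglongrightarrow> (\<Sum>v\<in>dverts. norm (0::real^3)) + (\<Sum>n\<in>dnormals. norm (0::real^3))"
      unfolding h_def by (intro tendsto_intros W B)
    then show ?thesis by simp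
  qed
  define w where "w k v = (1 / h k) *\<^sub>R W k v" for k v
  define b where "b k n = (1 / h k) *\<^sub>R B k n" for k n
  have WB: "W k = (\<lambda>v. h k *\<^sub>R w k v)" "B k = (\<lambda>n. h k *\<^sub>R b k n)" for k
    using hpos[of k] by (auto simp: w_def b_def)
  have flex': "flex_at (h k) (w k) (b k)" for k
    using flex_at_scale[of "h k" "w k" "b k"] flex[of k] hpos[of k] by (simp flip: WB)
  have gauged': "gauged (w k)" for k
    unfolding w_def by (rule gauged_scale[OF gauged])
  have sum1: "(\<Sum>v\<in>dverts. norm (w k v)) + (\<Sum>n\<in>dnormals. norm (b k n)) = 1" for k
  proof -
    have "(\<Sum>v\<in>dverts. norm (w k v)) + (\<Sum>n\<in>dnormals. norm (b k n)) = (1 / h k) * h k"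
      using hpos[of k] unfolding w_def b_def
      by (subst (3) h_def) (simp add: distrib_left sum_distrib_left)
    then show ?thesis using hpos[of k] by simp
  qed
  have nle: "v \<in> dverts \<Longrightarrow> norm (w k v) \<le> 1" "n \<in> dnormals \<Longrightarrow> norm (b k n) \<le> 1" for k v n
    using bounds[of _ k] hpos[of k] by (simp_all add: w_def b_def)
  have bdd: "v \<in> dverts \<Longrightarrow> bounded (range (\<lambda>k. w k v))" "n \<in> dnormals \<Longrightarrow> bounded (range (\<lambda>k. b (f k) n))"
    for v n and f :: "nat \<Rightarrow> nat"
    using nle by (auto intro!: boundedI[of _ 1])
  obtain u \<sigma> where \<sigma>: "strict_mono \<sigma>" "\<And>v. v \<in> dverts \<Longrightarrow> (\<lambda>k. w (\<sigma> k) v) \<longlonglongrightarrow> u v"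
    using finite_family_convergent_subsequence[of dverts w, OF finite_dverts bdd(1)] by auto
  obtain c \<tau> where \<tau>: "strict_mono \<tau>" "\<And>n. n \<in> dnormals \<Longrightarrow> (\<lambda>k. b (\<sigma> (\<tau> k)) n) \<longlonglongrightarrow> c n"
    using finite_family_convergent_subsequence[of dnormals "\<lambda>k. b (\<sigma> k)", OF finite_dnormals bdd(2)] by auto
  have wl: "\<And>v. v \<in> dverts \<Longrightarrow> (\<lambda>k. w (\<sigma> (\<tau> k)) v) \<longlonglongrightarrow> u v"
    using LIMSEQ_subseq_LIMSEQ[OF \<sigma>(2) \<tau>(1)] by (simp add: o_def)
  have hl: "(\<lambda>k. h (\<sigma> (\<tau> k))) \<longlonglongrightarrow> 0"
    using LIMSEQ_subseq_LIMSEQ[OF h0 strict_mono_o[OF \<sigma>(1) \<tau>(1)]] by (simp add: o_def)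
  note l0 = wl \<tau>(2)
  note l1 = conj_cyc_limit[OF l0]
  note l2 = conj_cyc_limit[OF l1]
  \<comment> \<open>The forms have to be seen to vanish before the limit: at scale 0 only the
    linearized constraints are left.\<close>
  have hnz: "h k \<noteq> 0" for k using hpos[of k] by simp
  note s0 = flex_at_stress_forms_vanish[OF flex' hnz]
    and s1 = flex_at_stress_forms_vanish[OF flex_at_cyc[OF flex'] hnz]
    and s2 = flex_at_stress_forms_vanish[OF flex_at_cyc[OF flex_at_cyc[OF flex']] hnz]
  note rigid = second_order_rigid[OF flex_at_limit[OF l0 hl flex'] gauged_limit[OF l0 gauged']
      stress_forms_vanish_limit[OF l0 s0] stress_forms_vanish_limit[OF l1 s1] stress_forms_vanish_limit[OF l2 s2]]
  have "(\<lambda>k. (\<Sum>v\<in>dverts. norm (w (\<sigma> (\<tau> k)) v)) + (\<Sum>n\<in>dnormals. norm (b (\<sigma> (\<tau> k)) n))) \<longlonglongrightarrow>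
      (\<Sum>v\<in>dverts. norm (u v)) + (\<Sum>n\<in>dnormals. norm (c n))"
    by (intro tendsto_intros l0)
  then have "(\<Sum>v\<in>dverts. norm (u v)) + (\<Sum>n\<in>dnormals. norm (c n)) = 1"
    unfolding sum1 using LIMSEQ_unique tendsto_const by blast
  then show False
    by (simp add: rigid)
qed

section \<open>Rigidity along motions\<close>

lemma compact_orthogonal_matrices: "compact {R :: real^'n^'n. orthogonal_matrix R}"
proof -
  have "norm R \<le> CARD('n)" if "orthogonal_matrix R" for R :: "real^'n^'n"
  proof -
    have "norm (R $ i) = 1" for i
      using that by (simp add: orthogonal_matrix_orthonormal_rows row_def)
    moreover have "norm R \<le> (\<Sum>i\<in>UNIV. norm (R $ i))"
      unfolding norm_vec_def by (rule L2_set_le_sum) simp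
    ultimately show ?thesis by simp
  qed
  then have "bounded {R :: real^'n^'n. orthogonal_matrix R}"
    by (auto intro: boundedI)
  moreover have "closed {R :: real^'n^'n. orthogonal_matrix R}"
  proof -
    have "{R :: real^'n^'n. orthogonal_matrix R} =
        (\<Inter>i. \<Inter>j. {R. (\<Sum>k\<in>UNIV. R $ k $ i * R $ k $ j) = (if i = j then 1 else 0)})"
      by (auto simp: orthogonal_matrix vec_eq_iff matrix_matrix_mult_def transpose_def mat_def)
    also have "closed \<dots>"
      by (intro closed_INT ballI closed_Collect_eq continuous_intros)
    finally show ?thesis .
  qed
  ultimately show ?thesis by (simp add: compact_eq_bounded_closed)
qed

lemma norm_orthogonal_matrix: "orthogonal_matrix (R :: real^'n^'n) \<Longrightarrow> norm (R *v x) = norm x"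
  using orthogonal_transformation_matrix[of "(*v) R"] by (simp add: orthogonal_transformation)

text \<open>The unit vector in the direction of \<open>(A, B)\<close> attains the value
  \<open>sqrt (A\<^sup>2 + B\<^sup>2)\<close>, which exceeds \<open>A\<close> unless
  \<open>B = 0\<close>. This is the stationarity condition at angle 0, without derivatives.\<close>

lemma linear_bound_on_circle:
  fixes A B :: real
  assumes "\<And>c s. c\<^sup>2 + s\<^sup>2 = 1 \<Longrightarrow> c * A + s * B \<le> A"
  shows "B = 0"
proof (rule ccontr)
  assume "B \<noteq> 0"
  define \<rho> where "\<rho> = sqrt (A\<^sup>2 + B\<^sup>2)"
  have \<rho>: "\<rho>\<^sup>2 = A\<^sup>2 + B\<^sup>2" "\<rho> > 0"
    using \<open>B \<noteq> 0\<close> by (simp_all add: \<rho>_def add_nonneg_pos)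
  have "(A/\<rho>)\<^sup>2 + (B/\<rho>)\<^sup>2 = 1"
    using \<rho> \<open>B \<noteq> 0\<close> by (simp add: power_divide flip: add_divide_distrib)
  from assms[OF this] have "A\<^sup>2 + B\<^sup>2 \<le> A * \<rho>"
    using \<rho>(2) by (simp add: field_simps power2_eq_square)
  then have "\<rho> * \<rho> \<le> A * \<rho>" using \<rho>(1) by (simp add: power2_eq_square)
  then have "\<rho> \<le> A" using \<rho>(2) by (rule mult_right_le_imp_le)
  then have "\<rho>\<^sup>2 \<le> A\<^sup>2" using \<rho>(2) by (simp add: power_mono)
  then show False using \<rho>(1) \<open>B \<noteq> 0\<close> by simp
qed

text \<open>An optimal alignment maximizes the sum of the inner products
  \<open>y v \<bullet> v\<close>. Comparison with the rotations about the three axes shows that the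
  moment matrix \<open>p\<close> is symmetric, and its antisymmetric part is the sum of the cross
  products.\<close>

lemma optimal_rotation_moment:
  fixes y :: "real^3 \<Rightarrow> real^3"
  assumes "finite V"
    and opt: "\<And>M. orthogonal_matrix M \<Longrightarrow> (\<Sum>v\<in>V. (norm (y v - v))\<^sup>2) \<le> (\<Sum>v\<in>V. (norm (M *v y v - v))\<^sup>2)"
  shows "(\<Sum>v\<in>V. cross3 (y v) v) = 0"
proof -
  have opt': "(\<Sum>v\<in>V. (M *v y v) \<bullet> v) \<le> (\<Sum>v\<in>V. y v \<bullet> v)" if "orthogonal_matrix M" for M :: "real^3^3"
  proof -
    have "(norm (a - v))\<^sup>2 = (norm a)\<^sup>2 + (norm v)\<^sup>2 - 2 * (a \<bullet> v)" for a v :: "real^3"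
      by (simp add: power2_norm_eq_inner algebra_simps inner_commute)
    then show ?thesis
      using opt[OF that] by (simp add: norm_orthogonal_matrix[OF that] sum.distrib sum_subtractf flip: sum_distrib_left)
  qed
  define p where "p i j = (\<Sum>v\<in>V. y v $ i * v $ j)" for i j
  define M1 M2 M3 :: "real \<Rightarrow> real \<Rightarrow> real^3^3" where
    "M1 c s = vector [vector [1, 0, 0], vector [0, c, -s], vector [0, s, c]]" and
    "M2 c s = vector [vector [c, 0, s], vector [0, 1, 0], vector [-s, 0, c]]" and
    "M3 c s = vector [vector [c, -s, 0], vector [s, c, 0], vector [0, 0, 1]]" for c s
  note M_defs = M1_def M2_def M3_def
  have orth: "orthogonal_matrix (M1 c s)" "orthogonal_matrix (M2 c s)" "orthogonal_matrix (M3 c s)"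
    if "c\<^sup>2 + s\<^sup>2 = 1" for c s
    using that
    by (simp_all add: M_defs orthogonal_matrix vec_eq_iff forall_3 matrix_matrix_mult_def transpose_def
        mat_def sum_3 power2_eq_square algebra_simps)
  have "p 2 3 - p 3 2 = 0"
  proof (rule linear_bound_on_circle)
    fix c s :: real assume "c\<^sup>2 + s\<^sup>2 = 1"
    from opt'[OF orth(1)[OF this]] show "c * (p 2 2 + p 3 3) + s * (p 2 3 - p 3 2) \<le> p 2 2 + p 3 3"
      by (simp add: p_def M_defs inner_3 matrix_vector_mult_def sum_3 sum.distrib sum_subtractf
          sum_distrib_left algebra_simps)
  qed
  moreover have "p 3 1 - p 1 3 = 0"
  proof (rule linear_bound_on_circle)
    fix c s :: real assume "c\<^sup>2 + s\<^sup>2 = 1"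
    from opt'[OF orth(2)[OF this]] show "c * (p 1 1 + p 3 3) + s * (p 3 1 - p 1 3) \<le> p 1 1 + p 3 3"
      by (simp add: p_def M_defs inner_3 matrix_vector_mult_def sum_3 sum.distrib sum_subtractf
          sum_distrib_left algebra_simps)
  qed
  moreover have "p 1 2 - p 2 1 = 0"
  proof (rule linear_bound_on_circle)
    fix c s :: real assume "c\<^sup>2 + s\<^sup>2 = 1"
    from opt'[OF orth(3)[OF this]] show "c * (p 1 1 + p 2 2) + s * (p 1 2 - p 2 1) \<le> p 1 1 + p 2 2"
      by (simp add: p_def M_defs inner_3 matrix_vector_mult_def sum_3 sum.distrib sum_subtractf
          sum_distrib_left algebra_simps)
  qed
  ultimately show ?thesis
    by (simp add: vec_eq_iff forall_3 cross3_def p_def sum_subtractf)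
qed

lemma sum_dverts_id: "(\<Sum>v\<in>dverts. v) = 0"
  by (simp add: sum_dverts sum_signs vec_eq_iff forall_3 point_defs)

lemma card_dverts: "card dverts = 20"
  using sum_dverts[of "\<lambda>_. 1 :: nat"] by (simp add: signs_def)

text \<open>The vertices have sum 0, so no linear functional equals 1 on all of them.\<close>

lemma facet_proper: "\<exists>v\<in>dverts. v \<bullet> n \<noteq> 1"
proof (rule ccontr)
  assume "\<not> ?thesis"
  then have "(\<Sum>v\<in>dverts. v \<bullet> n) = 20" by (simp add: card_dverts)
  then show False by (simp add: sum_dverts_id flip: inner_sum_left)
qed

text \<open>Three suitable vertices on the facet already determine its normal. This identifies
  limits of normals once the vertices are known to converge.\<close>

lemma normal_unique:
  assumes "n \<in> dnormals" "\<And>v. v \<in> dverts \<Longrightarrow> v \<bullet> n = 1 \<Longrightarrow> v \<bullet> x = 1"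
  shows "x = n"
  using assms(1)
proof (cases rule: dnormals_cases)
  case (X s t)
  have "vA 1 s t \<bullet> x = 1" "vA (-1) s t \<bullet> x = 1" "vB s t \<bullet> x = 1"
    using X assms(2) by (simp_all add: incidences)
  then have "x $ 1 = 0" "s * x $ 2 + t * x $ 3 = 1" "phi * (s * x $ 2) + (phi - 1) * (t * x $ 3) = 1"
    by (simp_all add: point_defs inner_3 algebra_simps)
  moreover from this have "s * x $ 2 = 2 - phi" "t * x $ 3 = phi - 1"
    using phi_sq by algebra+
  ultimately show ?thesis
    using X by (auto simp: signs_def nX_def vec_eq_iff forall_3)
next
  case (Y t r)
  have "vA r 1 t \<bullet> x = 1" "vA r (-1) t \<bullet> x = 1" "vC t r \<bullet> x = 1"
    using Y assms(2) by (simp_all add: incidences)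
  then have "x $ 2 = 0" "t * x $ 3 + r * x $ 1 = 1" "phi * (t * x $ 3) + (phi - 1) * (r * x $ 1) = 1"
    by (simp_all add: point_defs inner_3 algebra_simps)
  moreover from this have "t * x $ 3 = 2 - phi" "r * x $ 1 = phi - 1"
    using phi_sq by algebra+
  ultimately show ?thesis
    using Y by (auto simp: signs_def nY_def vec_eq_iff forall_3)
next
  case (Z r s)
  have "vA r s 1 \<bullet> x = 1" "vA r s (-1) \<bullet> x = 1" "vD r s \<bullet> x = 1"
    using Z assms(2) by (simp_all add: incidences)
  then have "x $ 3 = 0" "r * x $ 1 + s * x $ 2 = 1" "phi * (r * x $ 1) + (phi - 1) * (s * x $ 2) = 1"
    by (simp_all add: point_defs inner_3 algebra_simps)
  moreover from this have "r * x $ 1 = 2 - phi" "s * x $ 2 = phi - 1"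
    using phi_sq by algebra+
  ultimately show ?thesis
    using Z by (auto simp: signs_def nZ_def vec_eq_iff forall_3)
qed

lemma matrix_vector_tendsto:
  fixes R :: "'b \<Rightarrow> real^'n^'m"
  assumes "(R \<longlongrightarrow> R') F" "(x \<longlongrightarrow> x') F"
  shows "((\<lambda>k. R k *v x k) \<longlongrightarrow> R' *v x') F"
  unfolding matrix_vector_mult_def by (intro tendsto_intros assms)

lemma inner_orthogonal_matrix: "orthogonal_matrix (R :: real^'n^'n) \<Longrightarrow> (R *v x) \<bullet> (R *v y) = x \<bullet> y"
  using orthogonal_transformation_matrix[of "(*v) R"] by (simp add: orthogonal_transformation_def)

text \<open>The gauge is fixed by moving each realization to the orthogonal image closest to the dodecahedron, with the
  centroid of the vertices as new origin; the centroid lies strictly inside all facets, so that the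
  rescaled normals \<open>a'\<close> below are defined.\<close>

theorem motion_congruent:
  fixes p a :: "real \<Rightarrow> real^3 \<Rightarrow> real^3"
  assumes cp: "\<And>v. v \<in> dverts \<Longrightarrow> continuous_on {0..1} (\<lambda>t. p t v)"
    and ca: "\<And>n. n \<in> dnormals \<Longrightarrow> continuous_on {0..1} (\<lambda>t. a t n)"
    and inc: "\<And>t v n. t \<in> {0..1} \<Longrightarrow> v \<in> dverts \<Longrightarrow> n \<in> dnormals \<Longrightarrow> v \<bullet> n = 1 \<Longrightarrow> p t v \<bullet> a t n = 1"
    and ninc: "\<And>t v n. t \<in> {0..1} \<Longrightarrow> v \<in> dverts \<Longrightarrow> n \<in> dnormals \<Longrightarrow> v \<bullet> n \<noteq> 1 \<Longrightarrow> p t v \<bullet> a t n < 1"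
    and edge: "\<And>t v v'. t \<in> {0..1} \<Longrightarrow> v \<in> dverts \<Longrightarrow> v' \<in> dverts \<Longrightarrow> v \<bullet> v' = sqrt 5 \<Longrightarrow>
      norm (p t v - p t v') = norm (v - v')"
    and start: "\<And>v. v \<in> dverts \<Longrightarrow> p 0 v = v"
    and t: "t \<in> {0..1}" and v: "v \<in> dverts" "v' \<in> dverts"
  shows "norm (p t v - p t v') = norm (v - v')"
proof -
  define c where "c t = (1 / 20) *\<^sub>R (\<Sum>v\<in>dverts. p t v)" for t
  define q where "q t v = p t v - c t" for t v
  have sum_q: "(\<Sum>v\<in>dverts. q t v) = 0" for t
    unfolding q_def by (simp add: sum_subtractf c_def card_dverts)
  have cc: "continuous_on {0..1} c"
    unfolding c_def by (intro continuous_intros cp)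
  have cq: "continuous_on {0..1} (\<lambda>t. q t v)" if "v \<in> dverts" for v
    unfolding q_def by (intro continuous_intros cp cc that)
  \<comment> \<open>Here the strict inequalities of a realization enter: every vertex has value at
    most 1, some vertex has a smaller one, and \<open>c t\<close> is the average of the
    vertices.\<close>
  have ca_less: "c t \<bullet> a t n < 1" if t: "t \<in> {0..1}" and n: "n \<in> dnormals" for t n
  proof -
    have "\<exists>v\<in>dverts. p t v \<bullet> a t n < 1" using facet_proper[of n] ninc t n by blast
    moreover have "\<forall>v\<in>dverts. p t v \<bullet> a t n \<le> 1"
      using inc[OF t _ n] ninc[OF t _ n] by (metis less_imp_le order_refl)
    ultimately have "(\<Sum>v\<in>dverts. p t v \<bullet> a t n) < (\<Sum>v\<in>dverts. 1)"
      by (intro sum_strict_mono_ex1) auto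
    then show ?thesis by (simp add: c_def card_dverts inner_sum_left)
  qed
  define T where "T = {t\<in>{0..1}. \<exists>R. orthogonal_matrix R \<and> (\<forall>v\<in>dverts. R *v q t v = v)}"
  have seq: "(\<lambda>k. f (s k)) \<longlonglongrightarrow> f l" if "continuous_on {0..1} f" "\<And>k. s k \<in> {0..1}" "s \<longlonglongrightarrow> l" "l \<in> {0..1}"
    for f :: "real \<Rightarrow> real^3" and s l
    using continuous_on_tendsto_compose[OF that(1,3,4)] that(2) by simp
  have "closed T"
    unfolding closed_sequential_limits
  proof (intro allI impI, elim conjE)
    fix s l assume s: "\<forall>k. s k \<in> T" "s \<longlonglongrightarrow> l"
    then have l: "l \<in> {0..1}" and s01: "\<And>k. s k \<in> {0..1}"
      using closed_sequentially[of "{0..1::real}" s l] by (auto simp: T_def)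
    obtain R where R: "\<And>k. orthogonal_matrix (R k)" "\<And>k v. v \<in> dverts \<Longrightarrow> R k *v q (s k) v = v"
    proof -
      have "\<forall>k. \<exists>R. orthogonal_matrix R \<and> (\<forall>v\<in>dverts. R *v q (s k) v = v)"
        using s(1) by (simp add: T_def)
      then show ?thesis using that by metis
    qed
    obtain R' \<sigma> where R': "orthogonal_matrix R'" "strict_mono \<sigma>" "(R \<circ> \<sigma>) \<longlonglongrightarrow> R'"
      using compact_orthogonal_matrices[unfolded compact_def, rule_format, of R] R(1) by auto
    have "R' *v q l v = v" if v: "v \<in> dverts" for v
    proof -
      have "(\<lambda>k. (R \<circ> \<sigma>) k *v q ((s \<circ> \<sigma>) k) v) \<longlonglongrightarrow> R' *v q l v"
        by (intro matrix_vector_tendsto R' seq[OF cq[OF v]] LIMSEQ_subseq_LIMSEQ[OF s(2)] l) (simp only: o_def s01)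
      moreover have "(\<lambda>k. (R \<circ> \<sigma>) k *v q ((s \<circ> \<sigma>) k) v) = (\<lambda>_. v)"
        using R(2)[OF v] by simp
      ultimately show ?thesis by (simp add: LIMSEQ_const_iff)
    qed
    then show "l \<in> T" using l R'(1) by (auto simp: T_def)
  qed
  \<comment> \<open>This is relative openness of \<open>T\<close>, the step where rigidity enters:
    parameters outside \<open>T\<close> that converge to a point of \<open>T\<close> would yield
    arbitrarily small gauged flexes.\<close>
  moreover have "closed ({0..1} - T)"
    unfolding closed_sequential_limits
  proof (intro allI impI, elim conjE)
    fix s l assume s: "\<forall>k. s k \<in> {0..1} - T" "s \<longlonglongrightarrow> l"
    then have l: "l \<in> {0..1}" and s01: "\<And>k. s k \<in> {0..1}" and sT: "\<And>k. s k \<notin> T"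
      using closed_sequentially[of "{0..1::real}" s l] by auto
    show "l \<in> {0..1} - T"
    proof (rule ccontr)
      assume "\<not> ?thesis"
      with l obtain R0 where R0: "orthogonal_matrix R0" "\<And>v. v \<in> dverts \<Longrightarrow> R0 *v q l v = v"
        by (auto simp: T_def)
      define f where "f k R = (\<Sum>v\<in>dverts. (norm (R *v q (s k) v - v))\<^sup>2)" for k and R :: "real^3^3"
      have "\<exists>R. orthogonal_matrix R \<and> (\<forall>M. orthogonal_matrix M \<longrightarrow> f k R \<le> f k M)" for k
      proof -
        have "continuous_on {R. orthogonal_matrix R} (f k)"
          unfolding f_def matrix_vector_mult_def by (intro continuous_intros)
        then show ?thesis
          using continuous_attains_inf[OF compact_orthogonal_matrices] orthogonal_matrix_id by blast
      qed
      then obtain R where R: "\<And>k. orthogonal_matrix (R k)"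
        and opt: "\<And>k M. orthogonal_matrix M \<Longrightarrow> f k (R k) \<le> f k M"
        by metis
      define y where "y k v = R k *v q (s k) v" for k v
      \<comment> \<open>The minimizers \<open>R k\<close> themselves need not converge, but
        \<open>f k (R k) \<le> f k R0\<close>, and the right-hand side tends to 0.\<close>
      have y_lim: "(\<lambda>k. y k v) \<longlonglongrightarrow> v" if v: "v \<in> dverts" for v
      proof -
        have "(\<lambda>k. f k R0) \<longlonglongrightarrow> (\<Sum>v\<in>dverts. (norm (R0 *v q l v - v))\<^sup>2)"
          unfolding f_def
          by (intro tendsto_intros matrix_vector_tendsto seq[OF cq _ s(2) l] s01)
        then have f0: "(\<lambda>k. f k R0) \<longlonglongrightarrow> 0" by (simp add: R0(2))
        have le: "(norm (y k v - v))\<^sup>2 \<le> f k R0" for k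
          using member_le_sum[OF v _ finite_dverts, of "\<lambda>v. (norm (y k v - v))\<^sup>2"] opt[OF R0(1), of k]
          by (simp add: f_def y_def)
        have "\<forall>\<^sub>F k in sequentially. norm ((norm (y k v - v))\<^sup>2) \<le> f k R0"
          using le by (intro always_eventually allI) (simp only: real_norm_def abs_power2)
        then have "(\<lambda>k. (norm (y k v - v))\<^sup>2) \<longlonglongrightarrow> 0"
          using f0 by (rule Lim_null_comparison)
        from tendsto_real_sqrt[OF this] have "(\<lambda>k. norm (y k v - v)) \<longlonglongrightarrow> 0"
          by simp
        then show ?thesis by (rule LIM_zero_cancel[OF tendsto_norm_zero_cancel])
      qed
      obtain R' \<sigma> where R': "orthogonal_matrix R'" "strict_mono \<sigma>" "(R \<circ> \<sigma>) \<longlonglongrightarrow> R'"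
        using compact_orthogonal_matrices[unfolded compact_def, rule_format, of R] R by auto
      \<comment> \<open>Relative to the new origin \<open>c (s k)\<close>, incidence reads \<open>q
        (s k) v \<bullet> a (s k) n = 1 - c (s k) \<bullet> a (s k) n\<close>; the scalar factor
        restores the value 1.\<close>
      define a' where "a' k n = (1 / (1 - c (s k) \<bullet> a (s k) n)) *\<^sub>R (R k *v a (s k) n)" for k n
      have inc': "y k v \<bullet> a' k n = 1" if "v \<in> dverts" "n \<in> dnormals" "v \<bullet> n = 1" for k v n
      proof -
        have "y k v \<bullet> a' k n = (q (s k) v \<bullet> a (s k) n) / (1 - c (s k) \<bullet> a (s k) n)"
          by (simp add: y_def a'_def inner_orthogonal_matrix[OF R])
        also have "q (s k) v \<bullet> a (s k) n = 1 - c (s k) \<bullet> a (s k) n"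
          using inc[OF s01 that] by (simp add: q_def inner_diff_left)
        finally show ?thesis using ca_less[OF s01 that(2), of k] by simp
      qed
      have a'_lim: "(\<lambda>k. a' (\<sigma> k) n) \<longlonglongrightarrow> n" if n: "n \<in> dnormals" for n
      proof -
        let ?A = "(1 / (1 - c l \<bullet> a l n)) *\<^sub>R (R' *v a l n)"
        have s\<sigma>: "(\<lambda>k. s (\<sigma> k)) \<longlonglongrightarrow> l" and R\<sigma>: "(\<lambda>k. R (\<sigma> k)) \<longlonglongrightarrow> R'"
          using LIMSEQ_subseq_LIMSEQ[OF s(2) R'(2)] R'(3) by (simp_all add: o_def)
        have A: "(\<lambda>k. a' (\<sigma> k) n) \<longlonglongrightarrow> ?A"
          unfolding a'_def using ca_less[OF l n]
          by (intro tendsto_intros matrix_vector_tendsto R\<sigma> seq[OF ca[OF n] _ s\<sigma> l] seq[OF cc _ s\<sigma> l] s01) simp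
        \<comment> \<open>The limit of the normals is first known only up to \<open>R'\<close>;
          passing to the limit in the incidences shows that it satisfies the equations which
          characterize \<open>n\<close>.\<close>
        have "v \<bullet> ?A = 1" if v: "v \<in> dverts" "v \<bullet> n = 1" for v
        proof -
          have "(\<lambda>k. y (\<sigma> k) v \<bullet> a' (\<sigma> k) n) \<longlonglongrightarrow> v \<bullet> ?A"
            using LIMSEQ_subseq_LIMSEQ[OF y_lim[OF v(1)] R'(2)] by (intro tendsto_inner A) (simp add: o_def)
          then show ?thesis using inc'[OF v(1) n v(2)] by (simp add: LIMSEQ_const_iff)
        qed
        then have "?A = n" by (rule normal_unique[OF n])
        with A show ?thesis by simp
      qed
      have "\<exists>k. \<forall>v\<in>dverts. y (\<sigma> k) v - v = 0"
      proof (rule no_small_flex)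
        fix k
        show "flex_at 1 (\<lambda>v. y (\<sigma> k) v - v) (\<lambda>n. a' (\<sigma> k) n - n)"
          unfolding flex_at_def
        proof (intro conjI ballI impI)
          fix v n assume v: "v \<in> dverts" "n \<in> dnormals" "v \<bullet> n = 1"
          then show "(y (\<sigma> k) v - v) \<bullet> n + v \<bullet> (a' (\<sigma> k) n - n) + 1 * ((y (\<sigma> k) v - v) \<bullet> (a' (\<sigma> k) n - n)) = 0"
            using inc'[OF v] by (simp add: inner_diff_left inner_diff_right)
        next
          fix v v' assume v: "v \<in> dverts" "v' \<in> dverts" "v \<bullet> v' = sqrt 5"
          have "y (\<sigma> k) v - y (\<sigma> k) v' = R (\<sigma> k) *v (p (s (\<sigma> k)) v - p (s (\<sigma> k)) v')"
            by (simp add: y_def q_def flip: matrix_vector_mult_diff_distrib)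
          then have "norm (y (\<sigma> k) v - y (\<sigma> k) v') = norm (v - v')"
            using edge[OF s01 v] by (simp add: norm_orthogonal_matrix[OF R])
          then have e: "(y (\<sigma> k) v - y (\<sigma> k) v') \<bullet> (y (\<sigma> k) v - y (\<sigma> k) v') = (v - v') \<bullet> (v - v')"
            by (simp add: norm_eq)
          \<comment> \<open>With old and new edge vectors \<open>d\<close> and \<open>e\<close>, the
            claim is \<open>d \<bullet> (e - d) + (e - d) \<bullet> (e - d) / 2 = (e \<bullet> e - d
            \<bullet> d) / 2 = 0\<close>.\<close>
          define d where "d = v - v'"
          define e where "e = y (\<sigma> k) v - y (\<sigma> k) v'"
          have de: "e \<bullet> e = d \<bullet> d" and w: "y (\<sigma> k) v - v - (y (\<sigma> k) v' - v') = e - d"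
            using e by (simp_all add: d_def e_def)
          show "(v - v') \<bullet> (y (\<sigma> k) v - v - (y (\<sigma> k) v' - v')) +
            1 * ((y (\<sigma> k) v - v - (y (\<sigma> k) v' - v')) \<bullet> (y (\<sigma> k) v - v - (y (\<sigma> k) v' - v')) / 2) = 0"
            unfolding w d_def[symmetric]
            by (simp add: inner_diff_left inner_diff_right de inner_commute[of e d] diff_divide_distrib)
        qed
        have "(\<Sum>v\<in>dverts. y (\<sigma> k) v - v) = R (\<sigma> k) *v (\<Sum>v\<in>dverts. q (s (\<sigma> k)) v) - (\<Sum>v\<in>dverts. v)"
          by (simp add: y_def sum_subtractf linear_sum[OF matrix_vector_mul_linear])
        moreover have "(\<Sum>v\<in>dverts. cross3 (y (\<sigma> k) v) v) = 0"
        proof (rule optimal_rotation_moment[OF finite_dverts])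
          fix M :: "real^3^3" assume "orthogonal_matrix M"
          \<comment> \<open>\<open>M ** R (\<sigma> k)\<close> competes with the minimizer
            \<open>R (\<sigma> k)\<close>, so the aligned configuration cannot be improved by
            \<open>M\<close>.\<close>
          from opt[OF orthogonal_matrix_mul[OF this R], of "\<sigma> k" "\<sigma> k"]
          show "(\<Sum>v\<in>dverts. (norm (y (\<sigma> k) v - v))\<^sup>2) \<le> (\<Sum>v\<in>dverts. (norm (M *v y (\<sigma> k) v - v))\<^sup>2)"
            by (simp add: f_def y_def matrix_vector_mul_assoc)
        qed
        \<comment> \<open>Subtracting the dodecahedron preserves both conditions: its vertices have
          sum 0, and \<open>cross3 v v = 0\<close>.\<close>
        ultimately show "gauged (\<lambda>v. y (\<sigma> k) v - v)"
          by (simp add: gauged_def sum_q sum_dverts_id left_diff_distrib cross3_simps sum_subtractf)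
      next
        fix v assume "v \<in> dverts"
        from LIMSEQ_subseq_LIMSEQ[OF y_lim[OF this] R'(2)]
        show "(\<lambda>k. y (\<sigma> k) v - v) \<longlonglongrightarrow> 0" by (simp add: LIM_zero_iff o_def)
      next
        fix n assume "n \<in> dnormals"
        from a'_lim[OF this] show "(\<lambda>k. a' (\<sigma> k) n - n) \<longlonglongrightarrow> 0" by (simp add: LIM_zero_iff)
      qed
      then obtain k where "\<forall>v\<in>dverts. R (\<sigma> k) *v q (s (\<sigma> k)) v = v"
        by (auto simp: y_def)
      then show False using sT[of "\<sigma> k"] s01[of "\<sigma> k"] R[of "\<sigma> k"] by (auto simp: T_def)
    qed
  qed
  moreover have "0 \<in> T"
  proof -
    have "c 0 = 0" by (simp add: c_def start sum_dverts_id)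
    then have "\<forall>v\<in>dverts. mat 1 *v q 0 v = v" by (simp add: q_def start)
    then show ?thesis using orthogonal_matrix_id by (auto simp: T_def)
  qed
  ultimately have "{0..1} - T = {}"
    using connected_closedD[OF connected_Icc[of 0 "1::real"], of T "{0..1} - T"] by auto
  then obtain R where R: "orthogonal_matrix R" "\<And>v. v \<in> dverts \<Longrightarrow> R *v q t v = v"
    using t unfolding T_def by blast
  have "p t v - p t v' = q t v - q t v'" by (simp add: q_def)
  then have "norm (p t v - p t v') = norm (R *v (q t v - q t v'))"
    by (simp add: norm_orthogonal_matrix[OF R(1)])
  then show ?thesis by (simp add: matrix_vector_mult_diff_distrib R(2) v)
qed

section \<open>The faces of the dodecahedron\<close>

text \<open>A face of the hull of a finite set is the hull of some of its points, and these must lie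
  on the supporting hyperplane.\<close>

lemma supporting_face:
  fixes S :: "'a::euclidean_space set"
  assumes "finite S" and le: "\<And>x. x \<in> S \<Longrightarrow> a \<bullet> x \<le> b"
  shows "convex hull S \<inter> {x. a \<bullet> x = b} face_of convex hull S"
    and "convex hull S \<inter> {x. a \<bullet> x = b} = convex hull {x\<in>S. a \<bullet> x = b}"
proof -
  have "convex hull S \<subseteq> {x. a \<bullet> x \<le> b}"
    by (rule hull_minimal) (auto simp: le convex_halfspace_le)
  then show face: "convex hull S \<inter> {x. a \<bullet> x = b} face_of convex hull S"
    by (intro face_of_Int_supporting_hyperplane_le) auto
  obtain S' where S': "S' \<subseteq> S" "convex hull S \<inter> {x. a \<bullet> x = b} = convex hull S'"
    using face_of_convex_hull_subset[OF finite_imp_compact[OF assms(1)] face] .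
  have "S' \<subseteq> {x\<in>S. a \<bullet> x = b}"
    using S' hull_subset[of S' convex] by auto
  then have "convex hull S' \<subseteq> convex hull {x\<in>S. a \<bullet> x = b}"
    by (rule hull_mono)
  moreover have "convex hull {x\<in>S. a \<bullet> x = b} \<subseteq> convex hull S \<inter> {x. a \<bullet> x = b}"
    by (intro Int_greatest hull_mono hull_minimal) (auto simp: convex_hyperplane)
  ultimately show "convex hull S \<inter> {x. a \<bullet> x = b} = convex hull {x\<in>S. a \<bullet> x = b}"
    using S'(2) by simp
qed

lemma dverts_norm: "v \<in> dverts \<Longrightarrow> v \<bullet> v = 3"
  by (elim dverts_cases) (simp_all add: point_defs inner_3 algebra_simps phi_simps)

lemma sign_cases: "s \<in> signs \<Longrightarrow> (s = 1 \<Longrightarrow> P) \<Longrightarrow> (s = -1 \<Longrightarrow> P) \<Longrightarrow> P"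
  by (auto simp: signs_def)

lemma dnormals_inner_le:
  assumes "v \<in> dverts" "n \<in> dnormals"
  shows "n \<bullet> v \<le> 1"
  using assms
  by (elim dverts_cases dnormals_cases; hypsubst; elim sign_cases; hypsubst; use phi_bounds in \<open>simp add: point_defs inner_3 algebra_simps phi_simps\<close>)

text \<open>The case analysis runs over labels, and the value 3 takes the place of equality: vectors
  of squared norm 3 with inner product 3 coincide.\<close>

lemma dverts_inner_cases:
  assumes "v \<in> dverts" "v' \<in> dverts"
  shows "v \<bullet> v' = 3 \<or> v \<bullet> v' \<le> 2 * phi - 1"
  using assms
  by (elim dverts_cases; hypsubst; elim sign_cases; hypsubst; use phi_bounds in \<open>simp add: point_defs inner_3 algebra_simps phi_simps\<close>)

lemma sqrt_5_less: "sqrt 5 < 3"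
  by (rule real_less_lsqrt) auto

lemma dverts_inner_le:
  assumes "v \<in> dverts" "v' \<in> dverts" "v \<noteq> v'"
  shows "v \<bullet> v' \<le> sqrt 5"
proof -
  have "v \<bullet> v' \<noteq> 3"
  proof
    assume "v \<bullet> v' = 3"
    then have "(v - v') \<bullet> (v - v') = 0"
      using dverts_norm assms by (simp add: inner_diff_left inner_diff_right inner_commute)
    then show False using assms(3) by simp
  qed
  then show ?thesis using dverts_inner_cases[OF assms(1,2)] by (simp add: sqrt5_phi)
qed

text \<open>All vertices lie on a sphere about 0, so each \<open>v\<close> is the unique maximizer
  of its own inner product.\<close>

lemma extreme_points_dverts: "{v. v extreme_point_of (convex hull dverts)} = dverts"
proof (intro set_eqI iffI; (unfold mem_Collect_eq)?)
  fix v assume v: "v \<in> dverts"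
  have "v \<bullet> x \<le> 3" if "x \<in> dverts" for x
  proof (cases "x = v")
    case False
    then show ?thesis using dverts_inner_le[OF v that] sqrt_5_less by auto
  qed (simp add: dverts_norm v)
  moreover have "{x\<in>dverts. v \<bullet> x = 3} = {v}"
    using dverts_inner_le[OF v] dverts_norm[OF v] v sqrt_5_less by force
  ultimately have "{v} face_of convex hull dverts"
    using supporting_face[OF finite_dverts, of v 3] by simp
  then show "v extreme_point_of convex hull dverts"
    by (simp add: face_of_singleton)
qed (rule extreme_point_of_convex_hull)

text \<open>The functional \<open>v + v'\<close> takes the value \<open>3 + sqrt 5\<close> at both
  endpoints and at most \<open>2 * sqrt 5\<close> at every other vertex.\<close>

lemma edge_of_dverts:
  assumes v: "v \<in> dverts" "v' \<in> dverts" "v \<bullet> v' = sqrt 5"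
  shows "closed_segment v v' edge_of (convex hull dverts)"
proof -
  have ne: "v \<noteq> v'" using dverts_norm[OF v(1)] v(3) sqrt_5_less by auto
  have lt: "(v + v') \<bullet> x < 3 + sqrt 5" if "x \<in> dverts" "x \<noteq> v" "x \<noteq> v'" for x
    using dverts_inner_le[OF v(1) that(1)] dverts_inner_le[OF v(2) that(1)] that sqrt_5_less
    by (auto simp: inner_add_left)
  have eq: "(v + v') \<bullet> v = 3 + sqrt 5" "(v + v') \<bullet> v' = 3 + sqrt 5"
    using dverts_norm[OF v(1)] dverts_norm[OF v(2)] v(3)
        by (simp_all add: inner_add_left inner_commute[of v' v])
  have le: "(v + v') \<bullet> x \<le> 3 + sqrt 5" if "x \<in> dverts" for x
    using lt[OF that] eq by fastforce
  have "{x\<in>dverts. (v + v') \<bullet> x = 3 + sqrt 5} = {v, v'}"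
    using lt eq v by fastforce
  then have "closed_segment v v' face_of convex hull dverts"
    using supporting_face[OF finite_dverts le] by (simp add: segment_convex_hull)
  then show ?thesis
    using ne by (simp add: edge_of_def segment_convex_hull aff_dim_convex_hull)
qed

definition facet_at :: "real^3 \<Rightarrow> (real^3) set" where
  "facet_at n = convex hull dverts \<inter> {x. n \<bullet> x = 1}"

lemma facet_spanning:
  assumes "n \<in> dnormals"
  obtains x y z where "x \<in> dverts" "y \<in> dverts" "z \<in> dverts" "x \<bullet> n = 1" "y \<bullet> n = 1" "z \<bullet> n = 1"
      "\<not> collinear {x, y, z}"
proof -
  have *: "\<not> collinear {x, y, z}" if "cross3 (x - y) (z - y) \<noteq> 0" for x y z
    using that by (simp add: collinear_3 cross_eq_0)
  have "phi \<noteq> 1" using phi_bounds by simp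
  show ?thesis
    using assms
  proof (cases rule: dnormals_cases)
    case (X s t)
    then have "\<not> collinear {vA 1 s t, vA (-1) s t, vB s t}"
      using \<open>phi \<noteq> 1\<close> by (intro *) (auto simp: cross3_def point_defs vec_eq_iff forall_3)
    then show ?thesis
      using X by (intro that[of "vA 1 s t" "vA (-1) s t" "vB s t"]) (simp_all add: incidences)
  next
    case (Y t r)
    then have "\<not> collinear {vA r 1 t, vA r (-1) t, vC t r}"
      using \<open>phi \<noteq> 1\<close> by (intro *) (auto simp: cross3_def point_defs vec_eq_iff forall_3)
    then show ?thesis
      using Y by (intro that[of "vA r 1 t" "vA r (-1) t" "vC t r"]) (simp_all add: incidences)
  next
    case (Z r s)
    then have "\<not> collinear {vA r s 1, vA r s (-1), vD r s}"
      using \<open>phi \<noteq> 1\<close> by (intro *) (auto simp: cross3_def point_defs vec_eq_iff forall_3)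
    then show ?thesis
      using Z by (intro that[of "vA r s 1" "vA r s (-1)" "vD r s"]) (simp_all add: incidences)
  qed
qed

text \<open>A dimension squeeze: three non-collinear vertices give dimension at least 2, and a
  proper face has smaller dimension than the hull, which has dimension at most 3.\<close>

lemma facet_of_dverts:
  assumes n: "n \<in> dnormals" shows "facet_at n facet_of (convex hull dverts)"
proof -
  have face: "facet_at n face_of convex hull dverts"
    unfolding facet_at_def using dnormals_inner_le[OF _ n] by (intro supporting_face) auto
  obtain x y z where xyz: "x \<in> dverts" "y \<in> dverts" "z \<in> dverts" "x \<bullet> n = 1" "y \<bullet> n = 1" "z \<bullet> n = 1"
      "\<not> collinear {x, y, z}"
    using facet_spanning[OF n] .
  then have "{x, y, z} \<subseteq> facet_at n"
    by (auto simp: facet_at_def inner_commute hull_inc)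
  then have "\<not> collinear (facet_at n)"
    using xyz(7) collinear_subset by blast
  then have "aff_dim (facet_at n) \<ge> 2"
    by (simp add: collinear_aff_dim)
  moreover obtain v where v: "v \<in> dverts" "v \<bullet> n \<noteq> 1"
    using facet_proper[of n] by blast
  then have "v \<in> convex hull dverts" "v \<notin> facet_at n"
    by (simp_all add: hull_inc facet_at_def inner_commute[of n v])
  then have "facet_at n \<noteq> convex hull dverts" by blast
  then have "aff_dim (facet_at n) < aff_dim (convex hull dverts)"
    by (intro face_of_aff_dim_lt face) auto
  moreover have "aff_dim (convex hull dverts) \<le> 3"
    using aff_dim_le_DIM[of "convex hull dverts"] by simp
  ultimately have "aff_dim (facet_at n) = aff_dim (convex hull dverts) - 1" "facet_at n \<noteq> {}"
    by auto
  then show ?thesis using face by (simp add: facet_of_def)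
qed

text \<open>It suffices that the sets \<open>facet_at n\<close> are facets and that the pairs with
  inner product \<open>sqrt 5\<close> are edges: the constraints these impose on a motion already
  force congruence.\<close>

lemma rigid_dodecahedron: "rigid_polytope (convex hull dverts)"
  unfolding rigid_polytope_def trivial_motion_of_def vertex_congruent_def
proof (intro allI impI ballI)
  let ?C = "comb_type_of (convex hull dverts)"
  let ?r = "realization_of (convex hull dverts)"
  fix g t i j
  assume motion: "motion_of (convex hull dverts) g" and t: "t \<in> {0..1::real}"
    and ij: "i \<in> verts ?C" "j \<in> verts ?C"
  have verts: "verts ?C = dverts"
    by (simp add: comb_type_of_def extreme_points_dverts)
  have facets: "facet_at n \<in> facets ?C" if "n \<in> dnormals" for n
    using facet_of_dverts[OF that] by (simp add: comb_type_of_def)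
  have incident: "incident ?C v (facet_at n) \<longleftrightarrow> v \<bullet> n = 1" if "v \<in> dverts" for v n
    using that by (simp add: comb_type_of_def facet_at_def hull_inc inner_commute)
  have fst_r: "fst ?r v = v" if "v \<in> dverts" for v
    using that by (simp add: realization_of_def verts)
  have g: "continuous_on {0..1} g" and REAL: "\<And>t. t \<in> {0..1} \<Longrightarrow> g t \<in> REAL ?C" and g0: "g 0 = ?r"
    and equiv: "\<And>t. t \<in> {0..1} \<Longrightarrow> edge_equivalent ?C (g t) ?r"
    using motion unfolding motion_of_def path_def path_image_def pathstart_def by auto
  have rel: "(v \<bullet> n = 1 \<longrightarrow> fst (g t) v \<bullet> snd (g t) (facet_at n) = 1) \<and>
      (v \<bullet> n \<noteq> 1 \<longrightarrow> fst (g t) v \<bullet> snd (g t) (facet_at n) < 1)"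
    if "t \<in> {0..1}" "v \<in> dverts" "n \<in> dnormals" for t v n
  proof -
    have "\<forall>v\<in>dverts. \<forall>s\<in>facets ?C. (incident ?C v s \<longrightarrow> fst (g t) v \<bullet> snd (g t) s = 1) \<and>
        (\<not> incident ?C v s \<longrightarrow> fst (g t) v \<bullet> snd (g t) s < 1)"
      using REAL[OF that(1)] unfolding REAL_def verts by (simp add: case_prod_unfold)
    from bspec[OF bspec[OF this that(2)] facets[OF that(3)]] show ?thesis
      by (simp only: incident[OF that(2)])
  qed
  have "norm (fst (g t) i - fst (g t) j) = norm (i - j)"
  proof (rule motion_congruent[where p = "\<lambda>t. fst (g t)" and a = "\<lambda>t n. snd (g t) (facet_at n)"])
    show "continuous_on {0..1} (\<lambda>t. fst (g t) v)" for v
      by (rule continuous_on_product_then_coordinatewise[OF continuous_on_fst[OF g]])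
    show "continuous_on {0..1} (\<lambda>t. snd (g t) (facet_at n))" for n
      by (rule continuous_on_product_then_coordinatewise[OF continuous_on_snd[OF g]])
  next
    fix t v v' assume "t \<in> {0..1::real}" and v: "v \<in> dverts" "v' \<in> dverts" "v \<bullet> v' = sqrt 5"
    have "{v, v'} \<in> edges ?C"
      using edge_of_dverts[OF v] v extreme_points_dverts by (auto simp: comb_type_of_def)
    with equiv[OF \<open>t \<in> {0..1}\<close>] show "norm (fst (g t) v - fst (g t) v') = norm (v - v')"
      by (simp add: edge_equivalent_def fst_r v)
  qed (use rel t ij in \<open>simp_all add: g0 fst_r verts\<close>)
  then show "norm (fst (g t) i - fst (g t) j) = norm (fst ?r i - fst ?r j)"
    using ij by (simp add: fst_r verts)
qed

theorem theorem7p1: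
  fixes \<phi> :: real and P :: "(real^3) set"
  assumes "\<phi> = (1 + sqrt 5) / 2"
    and "P = convex hull
      ({vector [r, s, t] | r s t. r \<in> {1, -1} \<and> s \<in> {1, -1} \<and> t \<in> {1, -1}} \<union>
       {vector [0, s * \<phi>, t * (1 / \<phi>)] | s t. s \<in> {1, -1} \<and> t \<in> {1, -1}} \<union>
       {vector [s * (1 / \<phi>), 0, t * \<phi>] | s t. s \<in> {1, -1} \<and> t \<in> {1, -1}} \<union>
       {vector [s * \<phi>, t * (1 / \<phi>), 0] | s t. s \<in> {1, -1} \<and> t \<in> {1, -1}})"
  shows "rigid_polytope P"
proof -
  have \<phi>: "\<phi> = phi" using assms(1) by (simp add: phi_def)
  have "phi \<noteq> 0" using phi_bounds by auto
  then have inv: "1 / phi = phi - 1"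
    using phi_sq by (simp add: field_simps)
  have compr: "{f r s t | r s t. r \<in> S \<and> s \<in> S \<and> t \<in> S} = (\<lambda>(r, s, t). f r s t) ` (S \<times> S \<times> S)"
      "{h s t | s t. s \<in> S \<and> t \<in> S} = (\<lambda>(s, t). h s t) ` (S \<times> S)"
      "{h s t | s t. s \<in> S \<and> t \<in> S} = (\<lambda>(t, s). h s t) ` (S \<times> S)"
    for f :: "real \<Rightarrow> real \<Rightarrow> real \<Rightarrow> real^3" and h :: "real \<Rightarrow> real \<Rightarrow> real^3" and S
    by force+
  \<comment> \<open>\<open>vC\<close> takes the sign of its third coordinate first, so the third
    family is matched through the swapped form \<open>compr(3)\<close>.\<close>
  have "P = convex hull dverts"
    unfolding assms(2) dverts_def point_defs signs_def \<phi> inv compr(1) compr(2)[of "\<lambda>s t. vector [0, s * phi, t * (phi - 1)]"]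
      compr(3)[of "\<lambda>s t. vector [s * (phi
          - 1), 0, t * phi]"] compr(2)[of "\<lambda>s t. vector [s * phi, t * (phi - 1), 0]"] ..
  then show ?thesis by (simp add: rigid_dodecahedron)
qed

end
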